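(* Let $p,q$ be distinct primes and for $m,n\ge 0$ let $s(m,n)$ denote the number of saturated $C_{p^mq^n}$-transfer systems. For all $m,n\ge 0$, \[ s(m,n)=\sum_{j=2}^{m+2}(-1)^{m-j}\left\{{m+1 \atop j-1}\right\}\frac{j!}{2}\,j^n, \] where $\left\{{r \atop s}\right\}$ denotes the Stirling number of the second kind. Furthermore, the exponential generating function for $s(m,n)$ takes the form \[ \sum_{m,n\ge 0}\frac{s(m,n)}{m!\,n!}x^my^n = \frac{e^{2x+2y}}{(e^x+e^y-e^{x+y})^3}. \]
   Context: $C_k$ denotes the cyclic group of order $k$, and $\mathrm{Sub}(G)$ the lattice of subgroups of a finite group $G$. For an Abelian finite group $G$, a $G$-transfer system is a relation $\to$ on $\mathrm{Sub}(G)$ refining inclusion ($K\to H$ implies $K\le H$) such that: $H\to H$ for all $H\le G$ (reflexivity); $L\to K$ and $K\to H$ imply $L\to H$ (transitivity); $K\to H$ and $M\le H$ imply $K\cap M\to M$ (closure under restriction). (For general $G$ one also requires closure under conjugation, which is automatic for Abelian $G$.) A transfer system is saturated if whenever $L\le K\le H\le G$ and two of the three relations $L\to K$, $L\to H$, $K\to H$ hold, then so does the third. The number $s(m,n)$ does not depend on the choice of the distinct primes $p,q$. The Stirling number of the second kind $\left\{{r \atop s}\right\}$ is the number of partitions of a set of cardinality $r$ into $s$ nonempty blocks. The generating function identity is one of formal power series in $x,y$ (the denominator has constant term $1$). *)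

theory Defs
  imports
    "HOL-Algebra.Elementary_Groups"
    "HOL-Combinatorics.Stirling"
    "HOL-Computational_Algebra.Formal_Power_Series"
    "HOL-Computational_Algebra.Primes"
    "HOL-Library.Disjoint_Sets"
begin

section \<open>Transfer systems\<close>

text \<open>The relation \<open>K \<rightarrow> H\<close> is encoded as \<open>(K, H) \<in> R\<close>.  This is the notion for Abelian \<open>G\<close>,
  where closure under conjugation is automatic.\<close>

definition transfer_system :: "('a, 'b) monoid_scheme \<Rightarrow> 'a set rel \<Rightarrow> bool" where
  "transfer_system G R \<longleftrightarrow>
     (\<forall>K H. (K, H) \<in> R \<longrightarrow> subgroup K G \<and> subgroup H G \<and> K \<subseteq> H) \<and>
     refl_on {H. subgroup H G} R \<and>
     trans R \<and>
     (\<forall>K H M. (K, H) \<in> R \<longrightarrow> subgroup M G \<longrightarrow> M \<subseteq> H \<longrightarrow> (K \<inter> M, M) \<in> R)"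

definition saturated_transfer_system :: "('a, 'b) monoid_scheme \<Rightarrow> 'a set rel \<Rightarrow> bool" where
  "saturated_transfer_system G R \<longleftrightarrow>
     transfer_system G R \<and>
     (\<forall>L K H. subgroup L G \<longrightarrow> subgroup K G \<longrightarrow> subgroup H G \<longrightarrow> L \<subseteq> K \<longrightarrow> K \<subseteq> H \<longrightarrow>
        ((L, K) \<in> R \<and> (L, H) \<in> R \<longrightarrow> (K, H) \<in> R) \<and>
        ((L, K) \<in> R \<and> (K, H) \<in> R \<longrightarrow> (L, H) \<in> R) \<and>
        ((L, H) \<in> R \<and> (K, H) \<in> R \<longrightarrow> (L, K) \<in> R))"

definition num_saturated :: "nat \<Rightarrow> nat \<Rightarrow> nat \<Rightarrow> nat \<Rightarrow> nat" where
  "num_saturated p q m n =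
     card {R. saturated_transfer_system (integer_mod_group (p ^ m * q ^ n)) R}"

text \<open>The cardinality above is that of a finite set.\<close>

lemma finite_saturated_transfer_systems:
  assumes "finite (carrier G)"
  shows "finite {R. saturated_transfer_system G R}"
proof (rule finite_subset)
  show "{R. saturated_transfer_system G R} \<subseteq> Pow (Pow (carrier G) \<times> Pow (carrier G))"
    by (auto simp: saturated_transfer_system_def transfer_system_def dest!: subgroup.subset)
  show "finite (Pow (Pow (carrier G) \<times> Pow (carrier G)))"
    using assms by simp
qed


section \<open>Formal power series in two variables\<close>

text \<open>A series in \<open>x, y\<close> is a power series in \<open>y\<close> whose coefficients are power series in \<open>x\<close>:
  the coefficient of \<open>x\<^sup>m y\<^sup>n\<close> in \<open>F\<close> is \<open>fps_nth (fps_nth F n) m\<close>.\<close>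

type_synonym fps2 = "rat fps fps"

definition var_x :: fps2 where "var_x = fps_const fps_X"

definition var_y :: fps2 where "var_y = fps_X"

text \<open>\<open>exp F = \<Sum>k. F\<^sup>k / k!\<close>, meaningful for \<open>F\<close> with zero constant term only: then \<open>F\<^sup>k\<close> has no
  terms of total degree below \<open>k\<close>, so cutting off the sum at \<open>k = m + n\<close> loses nothing.\<close>

definition fps2_exp :: "fps2 \<Rightarrow> fps2" where
  "fps2_exp F = Abs_fps (\<lambda>n. Abs_fps (\<lambda>m.
     \<Sum>k\<le>m + n. fps_nth (fps_nth (F ^ k) n) m / fact k))"

text \<open>The division of iterated power series is the usual quotient when the denominator
  has constant coefficient (in \<open>y\<close>) equal to \<open>1\<close>.\<close>

lemma fps2_divide_mult_cancel:
  fixes F D :: fps2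
  assumes "fps_nth D 0 = 1"
  shows "F / D * D = F"
proof -
  have "subdegree D = 0" using assms by (simp add: subdegree_eq_0_iff)
  moreover have "D * inverse D = 1"
    using fps_right_inverse[of D 1] assms by (simp add: fps_inverse_def[of D])
  ultimately show ?thesis
    by (simp add: fps_divide_unit' mult.assoc mult.commute[of "inverse D"])
qed


section \<open>Stirling numbers count set partitions\<close>

text \<open>The library defines \<^const>\<open>Stirling\<close> by its recurrence; this is the combinatorial meaning.\<close>

lemma card_partitions_eq_Stirling:
  assumes "finite A"
  shows "card {P. partition_on A P \<and> card P = k} = Stirling (card A) k"
  using assms
proof (induction A arbitrary: k rule: finite_induct)
  case empty
  have "{P. partition_on ({} :: 'a set) P \<and> card P = k} = (if k = 0 then {{}} else {})"
    by (auto simp: partition_on_empty)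
  then show ?case by (cases k) (simp_all only: Stirling.simps card.empty, simp_all)
next
  case (insert a A)
  have fin: "finite {P. partition_on B P \<and> card P = k}" if "finite B" for B :: "'a set" and k
    by (rule finite_subset[of _ "Pow (Pow B)"]) (use that in \<open>auto simp: partition_on_def\<close>)
  have finP: "finite P" if "partition_on A P" for P
    using insert.hyps(1) that by (rule finite_elements)
  have img: "(\<lambda>c. c - {a}) ` Q = Q" if "\<forall>c\<in>Q. a \<notin> c" for Q :: "'a set set"
  proof -
    have "(\<lambda>c. c - {a}) ` Q = (\<lambda>c. c) ` Q"
    proof (rule image_cong)
      fix c assume "c \<in> Q"
      then show "c - {a} = c" using that by simp
    qed (rule refl)
    then show ?thesis by simp
  qed
  show ?case
  proof (cases k)
    case 0
    have "card P \<noteq> 0" if "partition_on (insert a A) P" for P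
    proof -
      have "finite P" using that insert.hyps(1) by (meson finite_elements finite_insert)
      moreover have "P \<noteq> {}" using that by (auto simp: partition_on_def)
      ultimately show ?thesis by simp
    qed
    then have "{P. partition_on (insert a A) P \<and> card P = 0} = {}" by blast
    moreover have "Stirling (card (insert a A)) 0 = 0" using insert.hyps by simp
    ultimately show ?thesis unfolding 0 by (simp only: card.empty)
  next
    case (Suc j)
    let ?T = "\<lambda>B i. {P. partition_on B P \<and> card P = i}"
    let ?S1 = "{P \<in> ?T (insert a A) k. {a} \<in> P}"
    let ?S2 = "{P \<in> ?T (insert a A) k. {a} \<notin> P}"
    have "bij_betw (\<lambda>P. insert {a} P) (?T A j) ?S1"
    proof (rule bij_betw_byWitness[where f' = "\<lambda>P. P - {{a}}"])
      show "\<forall>P\<in>?T A j. insert {a} P - {{a}} = P"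
        using insert.hyps(2) by (auto simp: partition_on_def)
      show "\<forall>P\<in>?S1. insert {a} (P - {{a}}) = P" by auto
      show "(\<lambda>P. insert {a} P) ` ?T A j \<subseteq> ?S1"
      proof (clarsimp, intro conjI)
        fix P assume P: "partition_on A P"
        show "partition_on (insert a A) (insert {a} P)"
          using P insert.hyps(2) unfolding partition_on_def disjoint_def by blast
        have "{a} \<notin> P" using P insert.hyps(2) by (auto simp: partition_on_def)
        then show "card (insert {a} P) = k" if "j = card P"
          using finP[OF P] Suc that by simp
      qed
      show "(\<lambda>P. P - {{a}}) ` ?S1 \<subseteq> ?T A j"
      proof (rule image_subsetI)
        fix P assume "P \<in> ?S1"
        then have P: "partition_on (insert a A) P" "{a} \<in> P" "k = card P" by auto
        have U: "\<Union>P = insert a A" and D: "disjoint P" and N: "{} \<notin> P"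
          using P(1) by (auto simp: partition_on_def)
        have nota: "a \<notin> b" if "b \<in> P - {{a}}" for b
          using disjointD[OF D P(2), of b] that by blast
        have "\<Union>(insert {a} (P - {{a}})) = insert a A"
          using U P(2) by (simp only: insert_Diff)
        then have "insert a (\<Union>(P - {{a}})) = insert a A"
          by (simp only: Union_insert insert_is_Un[symmetric])
        moreover have "a \<notin> \<Union>(P - {{a}})" using nota by blast
        ultimately have "\<Union>(P - {{a}}) = A" using insert.hyps(2) by (metis insert_ident)
        moreover have "disjoint (P - {{a}})" using D by (auto simp: disjoint_def)
        ultimately have "partition_on A (P - {{a}})" using N by (simp add: partition_on_def)
        moreover have "card (P - {{a}}) = j" using P Suc by simp
        ultimately show "P - {{a}} \<in> ?T A j" by simp
      qed
    qed
    then have c1: "card ?S1 = Stirling (card A) j"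
      using insert.IH[of j] by (simp add: bij_betw_same_card)
    have "bij_betw (\<lambda>(P, b). insert (insert a b) (P - {b})) (Sigma (?T A k) (\<lambda>P. P)) ?S2"
    proof (rule bij_betw_byWitness[where
        f' = "\<lambda>P. ((\<lambda>b. b - {a}) ` P, (THE b. b \<in> P \<and> a \<in> b) - {a})"])
      show "\<forall>Pb\<in>Sigma (?T A k) (\<lambda>P. P).
        (\<lambda>P. ((\<lambda>b. b - {a}) ` P, (THE b. b \<in> P \<and> a \<in> b) - {a}))
          ((\<lambda>(P, b). insert (insert a b) (P - {b})) Pb) = Pb"
      proof
        fix Pb assume "Pb \<in> Sigma (?T A k) (\<lambda>P. P)"
        then obtain P b where Pb: "Pb = (P, b)" and P: "partition_on A P" "b \<in> P" by auto
        have nota: "a \<notin> c" if "c \<in> P" for c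
          using that P insert.hyps(2) by (auto simp: partition_on_def)
        have "(THE c. c \<in> insert (insert a b) (P - {b}) \<and> a \<in> c) = insert a b"
          using nota by (intro the_equality) auto
        moreover have "(\<lambda>b. b - {a}) ` (P - {b}) = P - {b}"
          using nota by (intro img) blast
        moreover have "insert a b - {a} = b" using nota[OF P(2)] by simp
        moreover have "insert b (P - {b}) = P" using P(2) by (rule insert_Diff)
        ultimately show "(\<lambda>P. ((\<lambda>b. b - {a}) ` P, (THE b. b \<in> P \<and> a \<in> b) - {a}))
          ((\<lambda>(P, b). insert (insert a b) (P - {b})) Pb) = Pb"
          by (simp only: Pb prod.case image_insert)
      qed
      have *: "\<exists>b. b \<in> P \<and> a \<in> b \<and> (THE b. b \<in> P \<and> a \<in> b) = b \<and> (\<forall>c\<in>P - {b}. a \<notin> c) \<and>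
          b - {a} \<noteq> {} \<and> b - {a} \<notin> P \<and>
          (\<lambda>b. b - {a}) ` P = insert (b - {a}) (P - {b})"
        if P: "partition_on (insert a A) P" "{a} \<notin> P" for P
      proof -
        have U: "\<Union>P = insert a A" and D: "disjoint P" and N: "{} \<notin> P"
          using P(1) by (auto simp: partition_on_def)
        obtain b where b: "b \<in> P" "a \<in> b" using U by blast
        have nota: "\<forall>c\<in>P - {b}. a \<notin> c" using D b by (auto simp: disjoint_def)
        have "(THE b. b \<in> P \<and> a \<in> b) = b" using b nota by (intro the_equality) auto
        moreover have ne: "b - {a} \<noteq> {}"
        proof
          assume "b - {a} = {}"
          then have "b = {a}" using b(2) by blast
          then show False using b(1) P(2) by simp
        qed
        moreover have "b - {a} \<notin> P"
        proof
          assume "b - {a} \<in> P"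
          moreover have "b - {a} \<noteq> b" using b(2) by blast
          ultimately have "(b - {a}) \<inter> b = {}" using disjointD[OF D _ b(1)] by blast
          then show False using ne by blast
        qed
        moreover have "(\<lambda>b. b - {a}) ` P = insert (b - {a}) (P - {b})"
        proof -
          have "(\<lambda>b. b - {a}) ` (P - {b}) = P - {b}"
            using nota by (intro img) blast
          moreover have "(\<lambda>b. b - {a}) ` insert b (P - {b}) =
              insert (b - {a}) ((\<lambda>b. b - {a}) ` (P - {b}))" by (rule image_insert)
          moreover have "insert b (P - {b}) = P" using b by auto
          ultimately show ?thesis by (simp only:)
        qed
        ultimately show ?thesis using b nota by - (intro exI[of _ b] conjI; assumption)
      qed
      show "\<forall>P\<in>?S2. (\<lambda>(P, b). insert (insert a b) (P - {b}))
          ((\<lambda>P. ((\<lambda>b. b - {a}) ` P, (THE b. b \<in> P \<and> a \<in> b) - {a})) P) = P"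
      proof clarify
        fix P assume P: "partition_on (insert a A) P" "{a} \<notin> P"
        from *[OF P] obtain b where b: "b \<in> P" "a \<in> b" "(THE b. b \<in> P \<and> a \<in> b) = b"
          "b - {a} \<notin> P" "(\<lambda>b. b - {a}) ` P = insert (b - {a}) (P - {b})" by blast
        have "insert (insert a (b - {a})) (insert (b - {a}) (P - {b}) - {b - {a}}) = P"
          using b(1,2,4) by (auto simp: insert_absorb)
        then show "insert (insert a ((THE b. b \<in> P \<and> a \<in> b) - {a}))
            ((\<lambda>b. b - {a}) ` P - {(THE b. b \<in> P \<and> a \<in> b) - {a}}) = P"
          using b(3,5) by simp
      qed
      show "(\<lambda>(P, b). insert (insert a b) (P - {b})) ` Sigma (?T A k) (\<lambda>P. P) \<subseteq> ?S2"
      proof (rule image_subsetI)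
        fix Pb assume "Pb \<in> Sigma (?T A k) (\<lambda>P. P)"
        then obtain P b where Pb: "Pb = (P, b)" and
          P: "partition_on A P" "b \<in> P" "k = card P" by auto
        have U: "\<Union>P = A" and D: "disjoint P" and N: "{} \<notin> P"
          using P(1) by (auto simp: partition_on_def)
        have nota: "a \<notin> c" if "c \<in> P" for c
          using that U insert.hyps(2) by auto
        have "disjoint (insert (insert a b) (P - {b}))"
          using D P(2) nota unfolding disjoint_def by blast
        moreover have "\<Union>(insert (insert a b) (P - {b})) = insert a A"
        proof -
          have "\<Union>(insert (insert a b) (P - {b})) = insert a (\<Union>(insert b (P - {b})))"
            by (simp only: Union_insert Un_insert_left)
          then show ?thesis using U P(2) by (simp only: insert_Diff)
        qed
        ultimately have "partition_on (insert a A) (insert (insert a b) (P - {b}))"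
          using N by (simp add: partition_on_def)
        moreover have "card (insert (insert a b) (P - {b})) = card P"
        proof -
          have "insert a b \<notin> P - {b}" using nota by blast
          then show ?thesis using finP[OF P(1)] P(2)
            by (simp add: card_Suc_Diff1 del: card_Diff_insert)
        qed
        moreover have "{a} \<noteq> insert a b" 
        proof
          assume "{a} = insert a b"
          then have "b \<subseteq> {a}" by blast
          then have "b = {}" using nota[OF P(2)] by blast
          then show False using N P(2) by simp
        qed
        moreover have "{a} \<notin> P" using nota by blast
        ultimately show "(\<lambda>(P, b). insert (insert a b) (P - {b})) Pb \<in> ?S2"
          unfolding Pb using P(3) by simp
      qed
      show "(\<lambda>P. ((\<lambda>b. b - {a}) ` P, (THE b. b \<in> P \<and> a \<in> b) - {a})) ` ?S2
          \<subseteq> Sigma (?T A k) (\<lambda>P. P)"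
      proof (rule image_subsetI)
        fix P assume "P \<in> ?S2"
        then have P: "partition_on (insert a A) P" "{a} \<notin> P" "card P = k" by auto
        from *[OF P(1,2)] obtain b where b: "b \<in> P" "a \<in> b" "(THE b. b \<in> P \<and> a \<in> b) = b"
          "\<forall>c\<in>P - {b}. a \<notin> c" "b - {a} \<noteq> {}"
          "b - {a} \<notin> P" "(\<lambda>b. b - {a}) ` P = insert (b - {a}) (P - {b})"
          by (elim exE conjE) (rule that; assumption)
        have U: "\<Union>P = insert a A" and D: "disjoint P" and N: "{} \<notin> P"
          using P(1) by (auto simp: partition_on_def)
        have "finite P" using P(1) insert.hyps(1) by (meson finite_elements finite_insert)
        then have "card (insert (b - {a}) (P - {b})) = k"
          using b(1,6) P(3) by (simp add: card_Suc_Diff1 del: card_Diff_insert)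
        moreover have "disjoint (insert (b - {a}) (P - {b}))"
          using D b(1) unfolding disjoint_def by blast
        moreover have "\<Union>(insert (b - {a}) (P - {b})) = A"
        proof -
          have "insert a (\<Union>(insert (b - {a}) (P - {b}))) = \<Union>(insert b (P - {b}))"
            using b(2) unfolding Union_insert by blast
          also have "\<dots> = insert a A" using U b(1) by (simp only: insert_Diff)
          finally have "insert a (\<Union>(insert (b - {a}) (P - {b}))) = insert a A" .
          moreover have "a \<notin> \<Union>(insert (b - {a}) (P - {b}))" using b(4) by blast
          ultimately show ?thesis using insert.hyps(2) by (metis insert_ident)
        qed
        ultimately have "insert (b - {a}) (P - {b}) \<in> ?T A k"
          using N b(5) by (simp add: partition_on_def)
        then show "((\<lambda>b. b - {a}) ` P, (THE b. b \<in> P \<and> a \<in> b) - {a}) \<in> Sigma (?T A k) (\<lambda>P. P)"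
          using b(3,7) by simp
      qed
    qed
    then have "card ?S2 = card (Sigma (?T A k) (\<lambda>P. P))"
      by (simp add: bij_betw_same_card)
    also have "\<dots> = (\<Sum>P\<in>?T A k. card P)"
      by (rule card_SigmaI) (use fin[OF insert.hyps(1)] finP in auto)
    also have "\<dots> = k * Stirling (card A) k"
      using insert.IH[of k] by (simp add: mult.commute)
    finally have c2: "card ?S2 = k * Stirling (card A) k" .
    have "finite (?T (insert a A) k)" using fin insert.hyps(1) by simp
    then have "finite ?S1" "finite ?S2" by (rule finite_subset[rotated], blast)+
    then have "card (?S1 \<union> ?S2) = card ?S1 + card ?S2"
      by (intro card_Un_disjoint) auto
    moreover have "?S1 \<union> ?S2 = ?T (insert a A) k" by auto
    ultimately show ?thesis using c1 c2 insert.hyps Suc by simp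
  qed
qed

end

theory Submission
  imports Defs "HOL-Algebra.Multiplicative_Group"
begin

text \<open>
  The subgroup lattice of the cyclic group is the grid \<open>{0..m} \<times> {0..n}\<close>, and a saturated transfer
  system on it is determined by the covering relations it contains. Closure under restriction makes
  the horizontal edges between columns \<open>x\<close> and \<open>x + 1\<close> an initial segment, of length \<open>a\<close> say, and makes the
  sets \<open>V\<^sub>x\<close> of vertical edges decrease with \<open>x\<close>; transitivity and saturation say exactly that in a unit
  square whose left and bottom edges are present, the top edge is present iff the right one is.

  Adding a column on the left, and weighting a configuration by \<open>t\<close> to the number of missing vertical edges
  in its leftmost column, turns the total weight \<open>P\<^sub>m\<close> into
  \<open>P\<^sub>m\<^sub>+\<^sub>1(t) = (2 + t) P\<^sub>m(1 + t) - t P\<^sub>m(t)\<close> with \<open>P\<^sub>0(t) = (1 + t)\<^sup>n\<close>. Solving this and putting \<open>t = 1\<close> gives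
  the closed formula.

  The closed formula yields a recurrence in \<open>m\<close>, which says that the exponential generating function
  \<open>G\<close> satisfies \<open>L G = (1 + e\<^sup>y) G\<close> for the derivation \<open>L = d/dx - (e\<^sup>y - 1) d/dy\<close>. Since \<open>D = e\<^sup>x + e\<^sup>y - e\<^sup>x\<^sup>+\<^sup>y\<close> satisfies
  \<open>L D = (1 - e\<^sup>y) D\<close>, the product \<open>G D\<^sup>3\<close> solves the same first order equation as \<open>e\<^sup>2\<^sup>x\<^sup>+\<^sup>2\<^sup>y\<close>, with the same
  value at \<open>x = 0\<close>.
\<close>

section \<open>Subgroups of a cyclic group\<close>

text \<open>The elements killed by \<open>e\<close>. Allowing every \<open>e\<close> makes
  intersections into gcds without divisibility conditions; for \<open>e\<close> dividing
  \<open>N\<close> this is the subgroup of order \<open>e\<close>.\<close>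

definition torsion :: "nat \<Rightarrow> nat \<Rightarrow> int set" where
  "torsion N e = {x \<in> carrier (integer_mod_group N). int N dvd int e * x}"

lemma subgroup_torsion:
  assumes "N > 0"
  shows "subgroup (torsion N e) (integer_mod_group N)"
proof (rule group.subgroupI)
  let ?G = "integer_mod_group N"
  show "group ?G" by simp
  show "torsion N e \<subseteq> carrier ?G" by (auto simp: torsion_def)
  have "0 \<in> torsion N e" by (simp add: torsion_def)
  then show "torsion N e \<noteq> {}" by blast
  have dvd_mod: "int N dvd int e * (y mod int N) \<longleftrightarrow> int N dvd int e * y" for y
    by (simp add: dvd_eq_mod_eq_0 mod_mult_right_eq)
  show "inv\<^bsub>?G\<^esub> x \<in> torsion N e" if "x \<in> torsion N e" for x
    using that assms by (simp add: torsion_def dvd_mod) (simp add: carrier_integer_mod_group)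
  show "x \<otimes>\<^bsub>?G\<^esub> y \<in> torsion N e" if "x \<in> torsion N e" "y \<in> torsion N e" for x y
    using that assms
    by (simp add: torsion_def dvd_mod distrib_left) (simp add: carrier_integer_mod_group)
qed

text \<open>With \<open>N = e * d\<close>, the elements killed by \<open>e\<close> are the multiples
  of \<open>d\<close>.\<close>

lemma card_torsion:
  assumes "N > 0" "e dvd N"
  shows "card (torsion N e) = e"
proof -
  obtain d where N: "N = e * d" using assms by blast
  then have pos: "e > 0" "d > 0" using assms by auto
  have "torsion N e = (\<lambda>k. int d * int k) ` {..<e}"
  proof (intro equalityI subsetI)
    fix x assume x: "x \<in> torsion N e"
    then have "0 \<le> x" "x < int N" "int d dvd x"
      using assms pos N by (auto simp: torsion_def carrier_integer_mod_group)
    then obtain y where y: "x = int d * y" by blast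
    have "0 \<le> y" using \<open>0 \<le> x\<close> pos y by (simp add: zero_le_mult_iff)
    moreover have "y < int e" using \<open>x < int N\<close> pos y N by (simp add: mult.commute)
    ultimately show "x \<in> (\<lambda>k. int d * int k) ` {..<e}"
      using y by (intro image_eqI[of _ _ "nat y"]) (auto simp: nat_less_iff)
  next
    fix x assume "x \<in> (\<lambda>k. int d * int k) ` {..<e}"
    then obtain k where k: "x = int (d * k)" "k < e" by auto
    then have "d * k < N" using N pos by simp
    then show "x \<in> torsion N e"
      using k N assms by (simp add: torsion_def carrier_integer_mod_group del: of_nat_mult)
        (simp add: mult.assoc)
  qed
  moreover have "inj_on (\<lambda>k. int d * int k) {..<e}" using pos by (auto simp: inj_on_def)
  ultimately show ?thesis by (simp add: card_image)
qed

text \<open>By Lagrange every element of \<open>K\<close> is killed by \<open>card K\<close>, so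
  \<open>K\<close> lies in a torsion subgroup of the same finite cardinality.\<close>

lemma subgroup_eq_torsion:
  assumes "N > 0" "subgroup K (integer_mod_group N)"
  shows "card K dvd N \<and> K = torsion N (card K)"
proof
  let ?G = "integer_mod_group N"
  interpret G: group ?G by simp
  have fin: "finite (carrier ?G)" "order ?G = N"
    using assms by (simp_all add: carrier_integer_mod_group order_def)
  show dvd: "card K dvd N"
    using G.lagrange_finite[OF fin(1) assms(2)] fin(2) by (metis dvd_triv_right)
  have "K \<subseteq> torsion N (card K)"
  proof
    fix x assume x: "x \<in> K"
    interpret H: group "?G\<lparr>carrier := K\<rparr>"
      using assms(2) by (rule G.subgroup_imp_group)
    have "x [^]\<^bsub>?G\<lparr>carrier := K\<rparr>\<^esub> order (?G\<lparr>carrier := K\<rparr>) = \<one>\<^bsub>?G\<lparr>carrier := K\<rparr>\<^esub>"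
      using x by (intro H.pow_order_eq_1) simp
    then have "x [^]\<^bsub>?G\<^esub> card K = \<one>\<^bsub>?G\<^esub>"
      by (simp add: order_def nat_pow_def)
    then show "x \<in> torsion N (card K)"
      using x subgroup.mem_carrier[OF assms(2)] by (auto simp: torsion_def dvd_eq_mod_eq_0)
  qed
  moreover have "finite (torsion N (card K))"
    using fin(1) by (rule finite_subset[rotated]) (auto simp: torsion_def)
  ultimately show "K = torsion N (card K)"
    using card_torsion[OF assms(1) dvd] by (intro card_subset_eq) simp_all
qed

lemma torsion_Int: "torsion N d \<inter> torsion N e = torsion N (gcd d e)"
proof -
  have "int N dvd int (gcd d e) * x \<longleftrightarrow> int N dvd int d * x \<and> int N dvd int e * x" for x
  proof
    assume *: "int N dvd int d * x \<and> int N dvd int e * x"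
    \<comment> \<open>This gcd is \<open>gcd d e\<close> times the absolute value of
      \<open>x\<close>.\<close>
    then have "int N dvd gcd (int d * x) (int e * x)" by simp
    then show "int N dvd int (gcd d e) * x"
      by (simp add: gcd_mult_distrib_int[symmetric] mult.commute)
         (metis dvd_abs_iff abs_mult abs_of_nat mult.commute gcd_int_int_eq)
  qed (metis dvd_mult2 dvd_trans gcd_dvd1 gcd_dvd2 int_dvd_int_iff mult_dvd_mono dvd_refl)
  then show ?thesis by (auto simp: torsion_def)
qed

section \<open>The subgroup lattice as a grid of exponents\<close>

definition grid_subgroup :: "nat \<Rightarrow> nat \<Rightarrow> nat \<Rightarrow> nat \<Rightarrow> nat \<times> nat \<Rightarrow> int set" where
  "grid_subgroup p q m n = (\<lambda>(i, j). torsion (p ^ m * q ^ n) (p ^ i * q ^ j))"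

definition grid_meet :: "nat \<times> nat \<Rightarrow> nat \<times> nat \<Rightarrow> nat \<times> nat" where
  "grid_meet u v = (min (fst u) (fst v), min (snd u) (snd v))"

definition grid_le :: "nat \<times> nat \<Rightarrow> nat \<times> nat \<Rightarrow> bool" where
  "grid_le u v \<longleftrightarrow> fst u \<le> fst v \<and> snd u \<le> snd v"

definition grid :: "nat \<Rightarrow> nat \<Rightarrow> (nat \<times> nat) set" where
  "grid m n = {..m} \<times> {..n}"

lemma grid_le_iff_meet: "grid_le u v \<longleftrightarrow> grid_meet u v = u"
  by (cases u) (auto simp: grid_le_def grid_meet_def min_def)

lemma grid_meet_in_grid: "u \<in> grid m n \<Longrightarrow> grid_meet u v \<in> grid m n"
  by (auto simp: grid_def grid_meet_def)

context
  fixes p q :: nat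
  assumes pq: "prime p" "prime q" "p \<noteq> q"
begin

lemma grid_subgroup_meet:
  "grid_subgroup p q m n u \<inter> grid_subgroup p q m n v = grid_subgroup p q m n (grid_meet u v)"
proof -
  have cop: "coprime p q" "coprime q p"
    using pq by (simp_all add: primes_coprime)
  have "gcd (p ^ i * q ^ j) (p ^ i' * q ^ j') = p ^ min i i' * q ^ min j j'" for i j i' j'
  proof -
    let ?a = "min i i'" and ?b = "min j j'"
    have split: "r ^ k = r ^ l * r ^ (k - l)" if "l \<le> k" for r k l :: nat
      using that by (simp add: power_add[symmetric])
    \<comment> \<open>Of the two remaining exponents of \<open>p\<close> at least one is zero, and
      likewise for \<open>q\<close>, so the cofactors share no prime.\<close>
    have "coprime (p ^ (i - ?a) * q ^ (j - ?b)) (p ^ (i' - ?a) * q ^ (j' - ?b))"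
      using cop by (cases "i \<le> i'"; cases "j \<le> j'") simp_all
    moreover have "p ^ i * q ^ j = (p ^ ?a * q ^ ?b) * (p ^ (i - ?a) * q ^ (j - ?b))"
      "p ^ i' * q ^ j' = (p ^ ?a * q ^ ?b) * (p ^ (i' - ?a) * q ^ (j' - ?b))"
      using split[of ?a i p] split[of ?b j q] split[of ?a i' p] split[of ?b j' q]
      by (simp_all add: mult_ac)
    ultimately show ?thesis
      by (simp only: gcd_mult_distrib_nat[symmetric] coprime_iff_gcd_eq_1 mult_1_right)
  qed
  then show ?thesis
    by (cases u, cases v) (simp add: grid_subgroup_def torsion_Int grid_meet_def)
qed

text \<open>The order \<open>p ^ i * q ^ j\<close> recovers \<open>i\<close> and \<open>j\<close> as
  multiplicities, whence injectivity. Surjectivity holds because every divisor of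
  \<open>p ^ m * q ^ n\<close> has this shape and a subgroup is determined by its order.\<close>

lemma bij_grid_subgroup:
  "bij_betw (grid_subgroup p q m n) (grid m n)
     {H. subgroup H (integer_mod_group (p ^ m * q ^ n))}"
proof -
  let ?N = "p ^ m * q ^ n"
  have pos: "?N > 0" "p > 1" "q > 1" using pq by (simp_all add: prime_gt_0_nat prime_gt_1_nat[unfolded One_nat_def])
  have card: "card (grid_subgroup p q m n (i, j)) = p ^ i * q ^ j" if "(i, j) \<in> grid m n" for i j
    using that pos by (simp add: grid_subgroup_def grid_def card_torsion mult_dvd_mono le_imp_power_dvd)
  have mult: "multiplicity p (p ^ i * q ^ j) = i" "multiplicity q (p ^ i * q ^ j) = j" for i j
  proof -
    have "p ^ i \<noteq> 0" "q ^ j \<noteq> 0" using pos by simp_all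
    moreover have "multiplicity p (p ^ i) = i" "multiplicity q (q ^ j) = j"
      using pos by (simp_all add: multiplicity_same_power)
    moreover have "multiplicity p (q ^ j) = 0" "multiplicity q (p ^ i) = 0"
      using pq by (simp_all add: multiplicity_distinct_prime_power)
    ultimately show "multiplicity p (p ^ i * q ^ j) = i" "multiplicity q (p ^ i * q ^ j) = j"
      using prime_elem_multiplicity_mult_distrib[of p "p ^ i" "q ^ j"]
        prime_elem_multiplicity_mult_distrib[of q "p ^ i" "q ^ j"] pq
      by (simp_all add: prime_imp_prime_elem)
  qed
  have "inj_on (grid_subgroup p q m n) (grid m n)"
  proof (rule inj_onI)
    fix u v assume "u \<in> grid m n" "v \<in> grid m n"
      "grid_subgroup p q m n u = grid_subgroup p q m n v"
    then have "p ^ fst u * q ^ snd u = p ^ fst v * q ^ snd v"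
      using card[of "fst u" "snd u"] card[of "fst v" "snd v"] by simp
    then show "u = v"
      using mult[of "fst u" "snd u"] mult[of "fst v" "snd v"] by (simp add: prod_eq_iff)
  qed
  moreover have "grid_subgroup p q m n ` grid m n = {H. subgroup H (integer_mod_group ?N)}"
  proof (intro equalityI subsetI)
    fix H assume "H \<in> {H. subgroup H (integer_mod_group ?N)}"
    then have H: "card H dvd ?N" "H = torsion ?N (card H)"
      using subgroup_eq_torsion pos by blast+
    from division_decomp[OF H(1)] obtain a b where "card H = a * b" "a dvd p ^ m" "b dvd q ^ n"
      by blast
    then obtain i j where "card H = p ^ i * q ^ j" "i \<le> m" "j \<le> n"
      using divides_primepow_nat[OF pq(1)] divides_primepow_nat[OF pq(2)] by auto
    then have "H = grid_subgroup p q m n (i, j)" "(i, j) \<in> grid m n"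
      using H(2) by (simp_all only: grid_subgroup_def prod.case) (simp add: grid_def)
    then show "H \<in> grid_subgroup p q m n ` grid m n" by (rule image_eqI)
  qed (use pos in \<open>auto simp: grid_subgroup_def subgroup_torsion\<close>)
  ultimately show ?thesis by (simp add: bij_betw_def)
qed

end


section \<open>Counting column configurations\<close>

text \<open>\<open>V\<close> and \<open>W\<close> are the vertical edges of two neighbouring columns, an edge being named by the
  height of its upper end, and the horizontal edges between these columns are those at heights
  below \<open>a\<close>.\<close>

definition col_step :: "nat \<Rightarrow> nat set \<Rightarrow> nat set \<Rightarrow> bool" where
  "col_step a V W \<longleftrightarrow> W \<subseteq> V \<and> V \<inter> {1..<a} \<subseteq> W \<and> a \<notin> W"

text \<open>The thresholds in \<open>as\<close> go up to \<open>Suc n\<close> because a column has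
  \<open>n + 1\<close> heights, each of which may carry a horizontal edge.\<close>

definition configs :: "nat \<Rightarrow> nat \<Rightarrow> (nat list \<times> nat set list) set" where
  "configs m n = {(as, Vs). length as = m \<and> length Vs = Suc m \<and>
     (\<forall>x<m. as ! x \<le> Suc n) \<and> (\<forall>x\<le>m. Vs ! x \<subseteq> {1..n}) \<and>
     (\<forall>x<m. col_step (as ! x) (Vs ! x) (Vs ! Suc x))}"

definition config_weight :: "nat \<Rightarrow> nat \<Rightarrow> rat \<Rightarrow> rat" where
  "config_weight m n t = (\<Sum>c\<in>configs m n. t ^ card ({1..n} - hd (snd c)))"

lemma finite_configs: "finite (configs m n)"
proof (rule finite_subset)
  show "configs m n \<subseteq> {as. set as \<subseteq> {..Suc n} \<and> length as = m} \<times>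
      {Vs. set Vs \<subseteq> Pow {1..n} \<and> length Vs = Suc m}"
    by (auto simp: configs_def in_set_conv_nth less_Suc_eq_le subset_eq)
  show "finite ({as. set as \<subseteq> {..Suc n} \<and> length as = m} \<times>
      {Vs. set Vs \<subseteq> Pow {1..n} \<and> length Vs = Suc m})"
    by (intro finite_cartesian_product finite_lists_length_eq) auto
qed

lemma config_weight_1: "config_weight m n 1 = of_nat (card (configs m n))"
  by (simp add: config_weight_def)

section \<open>Weighted sums over the subsets of a column\<close>

lemma sum_Pow_power_card:
  fixes t :: rat
  assumes "finite S"
  shows "(\<Sum>U\<in>Pow S. t ^ card U) = (1 + t) ^ card S"
  using prod_add[OF assms, of "\<lambda>_. t" "\<lambda>_. 1"] by (simp add: add.commute)

lemma sum_between_power_card: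
  fixes t :: rat
  assumes "finite C" "B \<subseteq> C"
  shows "(\<Sum>U | B \<subseteq> U \<and> U \<subseteq> C. t ^ card U) = t ^ card B * (1 + t) ^ card (C - B)"
proof -
  have fin: "finite B" using assms finite_subset by blast
  have "(\<Sum>U | B \<subseteq> U \<and> U \<subseteq> C. t ^ card U) = (\<Sum>U\<in>Pow (C - B). t ^ (card B + card U))"
  proof (rule sum.reindex_bij_witness[where i = "\<lambda>U. B \<union> U" and j = "\<lambda>U. U - B"])
    fix U assume U: "U \<in> {U. B \<subseteq> U \<and> U \<subseteq> C}"
    then have "card (B \<union> (U - B)) = card B + card (U - B)"
      using fin assms finite_subset by (intro card_Un_disjoint) auto
    moreover have "B \<union> (U - B) = U" using U by blast
    ultimately show "t ^ (card B + card (U - B)) = t ^ card U" by simp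
  qed (use assms in auto)
  also have "\<dots> = t ^ card B * (1 + t) ^ card (C - B)"
    using sum_Pow_power_card[of "C - B" t] assms
    by (simp add: power_add sum_distrib_left[symmetric])
  finally show ?thesis .
qed

text \<open>With \<open>k = card C\<close>, the \<open>i\<close>-th smallest element of
  \<open>C\<close> contributes \<open>t ^ (i - 1) * (1 + t) ^ (k - i + 1)\<close>. This is a
  geometric sum whose usual denominator is \<open>(1 + t) - t = 1\<close>.\<close>

lemma sum_threshold_power_card:
  fixes t :: rat and C :: "nat set"
  assumes C: "C \<subseteq> {1..n}"
  shows "(\<Sum>a\<in>C. t ^ card (C \<inter> {1..<a}) * (1 + t) ^ card (C \<inter> {a..n})) =
    (1 + t) * ((1 + t) ^ card C - t ^ card C)"
proof -
  define G where "G a = t ^ card (C \<inter> {1..<a}) * (1 + t) ^ card (C \<inter> {a..n})" for a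
  have fin: "finite C" using C by (rule finite_subset) simp
  \<comment> \<open>the summand is \<open>G\<close>, and \<open>(1 + t) G\<close> telescopes\<close>
  have step: "(1 + t) * (G a - G (Suc a)) = (if a \<in> C then G a else 0)" if "a \<in> {1..n}" for a
  proof (cases "a \<in> C")
    case True
    have "C \<inter> {1..<Suc a} = insert a (C \<inter> {1..<a})" using True that by auto
    then have 1: "card (C \<inter> {1..<Suc a}) = Suc (card (C \<inter> {1..<a}))" using fin by simp
    have "C \<inter> {a..n} = insert a (C \<inter> {Suc a..n})" using True that by auto
    then have 2: "card (C \<inter> {a..n}) = Suc (card (C \<inter> {Suc a..n}))" using fin by simp
    show ?thesis unfolding G_def 1 2 using True by (simp add: algebra_simps)
  next
    case False
    then have "x < Suc a \<longleftrightarrow> x < a" "a \<le> x \<longleftrightarrow> Suc a \<le> x" if "x \<in> C" for x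
      using that by (cases "x = a"; force)+
    then have "C \<inter> {1..<Suc a} = C \<inter> {1..<a}" "C \<inter> {a..n} = C \<inter> {Suc a..n}"
      by (simp_all add: set_eq_iff) blast+
    then show ?thesis using False by (simp add: G_def)
  qed
  have "(\<Sum>a\<in>C. G a) = (\<Sum>a\<in>{1..n}. if a \<in> C then G a else 0)"
    using C by (simp add: sum.If_cases Int_absorb1)
  also have "\<dots> = (\<Sum>a=1..n. (1 + t) * (G a - G (Suc a)))"
    using step by (intro sum.cong) simp_all
  also have "\<dots> = (1 + t) * (G 1 - G (Suc n))"
  proof -
    have "(\<Sum>a=1..n. G a - G (Suc a)) = - (\<Sum>a=1..n. G (Suc a) - G a)"
      by (subst sum_negf[symmetric]) simp
    then show ?thesis
      by (simp add: sum_distrib_left[symmetric] sum_Suc_diff)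
  qed
  finally have "(\<Sum>a\<in>C. G a) = (1 + t) * (G 1 - G (Suc n))" .
  moreover have "C \<inter> {1..n} = C" "C \<inter> {1..<Suc n} = C" using C by auto
  then have "G 1 = (1 + t) ^ card C" "G (Suc n) = t ^ card C" by (simp_all add: G_def)
  ultimately show ?thesis by (simp add: G_def)
qed

text \<open>The transfer step of the count: with the right column \<open>W\<close> fixed, sum over
  all thresholds and left columns. The result depends on \<open>W\<close> only through its number of
  missing edges, so one variable \<open>t\<close> suffices to iterate.\<close>

lemma sum_col_step:
  fixes t :: rat
  assumes W: "W \<subseteq> {1..n}"
  defines "k \<equiv> card ({1..n} - W)"
  shows "(\<Sum>(a, V) | a \<le> Suc n \<and> V \<subseteq> {1..n} \<and> col_step a V W. t ^ card ({1..n} - V)) =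
    (2 + t) * (1 + t) ^ k - t * t ^ k"
proof -
  define C where "C = {1..n} - W"
  have CC: "C \<subseteq> {1..n}" "finite C" by (auto simp: C_def)
  have inner: "(\<Sum>V | V \<subseteq> {1..n} \<and> col_step a V W. t ^ card ({1..n} - V)) =
      (if a \<in> W then 0 else t ^ card (C \<inter> {1..<a}) * (1 + t) ^ card (C \<inter> {a..n}))" for a
  proof (cases "a \<in> W")
    case False
    \<comment> \<open>In terms of the missing edges of the left column, the step condition becomes
      membership in an interval of sets below \<open>C\<close>.\<close>
    have *: "V \<subseteq> {1..n} \<and> col_step a V W \<longleftrightarrow>
        C \<inter> {1..<a} \<subseteq> {1..n} - V \<and> {1..n} - V \<subseteq> C" if "V \<subseteq> {1..n}" for V
      using W False that unfolding col_step_def C_def by blast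
    have **: "{1..n} - ({1..n} - V) = V" if "V \<subseteq> {1..n}" for V :: "nat set"
      using that by (rule double_diff) simp
    have "(\<Sum>V | V \<subseteq> {1..n} \<and> col_step a V W. t ^ card ({1..n} - V)) =
        (\<Sum>U | C \<inter> {1..<a} \<subseteq> U \<and> U \<subseteq> C. t ^ card U)"
    proof (rule sum.reindex_bij_witness[where i = "\<lambda>U. {1..n} - U" and j = "\<lambda>U. {1..n} - U"])
      fix V assume "V \<in> {V. V \<subseteq> {1..n} \<and> col_step a V W}"
      then show "{1..n} - ({1..n} - V) = V"
        "{1..n} - V \<in> {U. C \<inter> {1..<a} \<subseteq> U \<and> U \<subseteq> C}"
        using * ** by blast+
    next
      fix U assume "U \<in> {U. C \<inter> {1..<a} \<subseteq> U \<and> U \<subseteq> C}"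
      moreover from this have "U \<subseteq> {1..n}" using CC by blast
      ultimately show "{1..n} - ({1..n} - U) = U"
        "{1..n} - U \<in> {V. V \<subseteq> {1..n} \<and> col_step a V W}"
        using *[of "{1..n} - U"] **[of U] by auto
    qed simp
    moreover have "C - C \<inter> {1..<a} = C \<inter> {a..n}" using CC by auto
    ultimately show ?thesis using False CC by (simp add: sum_between_power_card)
  qed (simp add: col_step_def)
  have "{(a, V). a \<le> Suc n \<and> V \<subseteq> {1..n} \<and> col_step a V W} =
      Sigma {..Suc n} (\<lambda>a. {V. V \<subseteq> {1..n} \<and> col_step a V W})" by auto
  then have "(\<Sum>(a, V) | a \<le> Suc n \<and> V \<subseteq> {1..n} \<and> col_step a V W. t ^ card ({1..n} - V)) =
      (\<Sum>a\<le>Suc n. \<Sum>V | V \<subseteq> {1..n} \<and> col_step a V W. t ^ card ({1..n} - V))"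
    by (simp add: sum.Sigma del: sum.atMost_Suc)
  \<comment> \<open>The admissible thresholds are those outside \<open>W\<close>: the two extremes
    \<open>0\<close> and \<open>Suc n\<close>, and the elements of \<open>C\<close>. The extremes
    contribute \<open>(1 + t) ^ card C\<close> and \<open>t ^ card C\<close>.\<close>
  also have "\<dots> = (\<Sum>a\<in>insert 0 (insert (Suc n) C). 
      t ^ card (C \<inter> {1..<a}) * (1 + t) ^ card (C \<inter> {a..n}))"
    unfolding inner
  proof (rule sum.mono_neutral_cong_right)
    show "insert 0 (insert (Suc n) C) \<subseteq> {..Suc n}" using CC by auto
    show "\<forall>a\<in>{..Suc n} - insert 0 (insert (Suc n) C). (if a \<in> W then 0 else
        t ^ card (C \<inter> {1..<a}) * (1 + t) ^ card (C \<inter> {a..n})) = 0"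
      by (auto simp: C_def)
    show "(if a \<in> W then 0 else t ^ card (C \<inter> {1..<a}) * (1 + t) ^ card (C \<inter> {a..n})) =
        t ^ card (C \<inter> {1..<a}) * (1 + t) ^ card (C \<inter> {a..n})"
      if "a \<in> insert 0 (insert (Suc n) C)" for a
      using that W by (auto simp: C_def)
  qed simp
  also have "\<dots> = (1 + t) ^ card C + t ^ card C +
      (\<Sum>a\<in>C. t ^ card (C \<inter> {1..<a}) * (1 + t) ^ card (C \<inter> {a..n}))"
  proof -
    have "0 \<notin> insert (Suc n) C" "Suc n \<notin> C" using CC by auto
    moreover have "C \<inter> {0..n} = C" "C \<inter> {1..<Suc n} = C" using CC by auto
    ultimately show ?thesis using CC by simp
  qed
  also have "\<dots> = (2 + t) * (1 + t) ^ k - t * t ^ k"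
    unfolding sum_threshold_power_card[OF CC(1)] k_def C_def[symmetric] by (simp add: algebra_simps)
  finally show ?thesis .
qed

lemma config_weight_0: "config_weight 0 n t = (1 + t) ^ n"
proof -
  have eq: "configs 0 n = (\<lambda>V. ([], [V])) ` Pow {1..n}"
    by (auto simp: configs_def length_Suc_conv)
  have "config_weight 0 n t = (\<Sum>V\<in>Pow {1..n}. t ^ card ({1..n} - V))"
    unfolding config_weight_def eq by (subst sum.reindex) (auto simp: inj_on_def)
  also have "\<dots> = (\<Sum>V\<in>Pow {1..n}. t ^ card V)"
    by (rule sum.reindex_bij_witness[where i = "\<lambda>U. {1..n} - U" and j = "\<lambda>U. {1..n} - U"]) auto
  finally show ?thesis using sum_Pow_power_card[of "{1..n}" t] by simp
qed

text \<open>A longer configuration prepends a threshold and a column, and the old leftmost column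
  plays the part of \<open>W\<close>. Each old weight \<open>t ^ k\<close> is thereby replaced by
  \<open>(2 + t) * (1 + t) ^ k - t * t ^ k\<close>.\<close>

lemma config_weight_Suc:
  "config_weight (Suc m) n t = (2 + t) * config_weight m n (1 + t) - t * config_weight m n t"
proof -
  let ?E = "\<lambda>c. {(a, V). a \<le> Suc n \<and> V \<subseteq> {1..n} \<and> col_step a V (hd (snd c))}"
  have fin: "finite (?E c)" for c
    by (rule finite_subset[of _ "{..Suc n} \<times> Pow {1..n}"]) auto
  have all_Suc: "(\<forall>x<Suc k. Q x) \<longleftrightarrow> Q 0 \<and> (\<forall>x<k. Q (Suc x))"
    "(\<forall>x\<le>Suc k. Q x) \<longleftrightarrow> Q 0 \<and> (\<forall>x\<le>k. Q (Suc x))" for Q :: "nat \<Rightarrow> bool" and k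
    by (auto simp: less_Suc_eq_0_disj) (metis Suc_le_mono not0_implies_Suc)
  have cons: "(a # as, V # Vs) \<in> configs (Suc m) n \<longleftrightarrow>
      (as, Vs) \<in> configs m n \<and> (a, V) \<in> ?E (as, Vs)" for a as V Vs
    by (cases Vs) (auto simp: configs_def all_Suc)
  have "config_weight (Suc m) n t =
      (\<Sum>(c, (a, V))\<in>Sigma (configs m n) ?E. t ^ card ({1..n} - V))"
    unfolding config_weight_def
  proof (rule sum.reindex_bij_witness[where
        i = "\<lambda>(c, (a, V)). (a # fst c, V # snd c)" and
        j = "\<lambda>(as, Vs). ((tl as, tl Vs), (hd as, hd Vs))"])
    fix c assume c: "c \<in> configs (Suc m) n"
    then obtain a as V Vs where *: "c = (a # as, V # Vs)"
      by (auto simp: configs_def length_Suc_conv)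
    show "(case case c of (as, Vs) \<Rightarrow> ((tl as, tl Vs), hd as, hd Vs) of
        (c, a, V) \<Rightarrow> (a # fst c, V # snd c)) = c" by (simp add: *)
    show "(case c of (as, Vs) \<Rightarrow> ((tl as, tl Vs), hd as, hd Vs)) \<in> Sigma (configs m n) ?E"
      using c cons unfolding * by simp
    show "(case case c of (as, Vs) \<Rightarrow> ((tl as, tl Vs), hd as, hd Vs) of
        (c, a, V) \<Rightarrow> t ^ card ({1..n} - V)) = t ^ card ({1..n} - hd (snd c))" by (simp add: *)
  next
    fix d assume d: "d \<in> Sigma (configs m n) ?E"
    then obtain as Vs a V where *: "d = ((as, Vs), (a, V))" by (metis prod.exhaust)
    show "(case case d of (c, a, V) \<Rightarrow> (a # fst c, V # snd c) of
        (as, Vs) \<Rightarrow> ((tl as, tl Vs), hd as, hd Vs)) = d" by (simp add: *)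
    show "(case d of (c, a, V) \<Rightarrow> (a # fst c, V # snd c)) \<in> configs (Suc m) n"
      using d cons unfolding * by simp
  qed
  also have "\<dots> = (\<Sum>c\<in>configs m n. \<Sum>(a, V)\<in>?E c. t ^ card ({1..n} - V))"
    by (rule sum.Sigma[symmetric]) (use finite_configs fin in auto)
  also have "\<dots> = (\<Sum>c\<in>configs m n. (2 + t) * (1 + t) ^ card ({1..n} - hd (snd c)) -
      t * t ^ card ({1..n} - hd (snd c)))"
  proof (rule sum.cong)
    fix c assume "c \<in> configs m n"
    then obtain as Vs where c: "c = (as, Vs)" "Vs \<noteq> []" "Vs ! 0 \<subseteq> {1..n}"
      by (force simp: configs_def)
    then have "hd (snd c) \<subseteq> {1..n}" by (simp add: hd_conv_nth)
    then show "(\<Sum>(a, V)\<in>?E c. t ^ card ({1..n} - V)) =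
        (2 + t) * (1 + t) ^ card ({1..n} - hd (snd c)) - t * t ^ card ({1..n} - hd (snd c))"
      by (rule sum_col_step)
  qed simp
  finally show ?thesis
    by (simp add: config_weight_def sum_subtractf sum_distrib_left)
qed

text \<open>\<open>shifted_Stirling m k t\<close> is the complete homogeneous symmetric polynomial of degree \<open>m - k\<close> in
  \<open>t, t + 1, \<dots>, t + k\<close>. The defining recurrence splits off the variable \<open>t\<close>, while
  \<open>shifted_Stirling_rec\<close> splits off \<open>t + k\<close>.\<close>

fun shifted_Stirling :: "nat \<Rightarrow> nat \<Rightarrow> rat \<Rightarrow> rat" where
  "shifted_Stirling 0 0 t = 1"
| "shifted_Stirling 0 (Suc k) t = 0"
| "shifted_Stirling (Suc m) 0 t = t * shifted_Stirling m 0 t"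
| "shifted_Stirling (Suc m) (Suc k) t =
     shifted_Stirling m k (t + 1) + t * shifted_Stirling m (Suc k) t"

lemma shifted_Stirling_0_right: "shifted_Stirling m 0 t = t ^ m"
  by (induction m) auto

lemma shifted_Stirling_eq_0: "m < k \<Longrightarrow> shifted_Stirling m k t = 0"
  by (induction m k t rule: shifted_Stirling.induct) auto

lemma shifted_Stirling_rec:
  "shifted_Stirling (Suc m) (Suc k) t =
     shifted_Stirling m k t + (t + of_nat (Suc k)) * shifted_Stirling m (Suc k) t"
proof (induction m arbitrary: k t)
  case 0
  show ?case by (cases k) auto
next
  case (Suc m)
  show ?case
  proof (cases k)
    case 0
    then show ?thesis
      using Suc.IH[of 0 t] by (simp add: shifted_Stirling_0_right algebra_simps)
  next
    case (Suc l)
    have "shifted_Stirling (Suc (Suc m)) (Suc k) t =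
        shifted_Stirling (Suc m) k (t + 1) + t * shifted_Stirling (Suc m) (Suc k) t" by simp
    \<comment> \<open>The induction hypothesis is used at \<open>t + 1\<close> and at
      \<open>t\<close>; both uses split off the same last variable
      \<open>t + of_nat (Suc k)\<close>, which then factors out.\<close>
    also have "\<dots> = shifted_Stirling m l (t + 1) + (t + 1 + of_nat k) * shifted_Stirling m k (t + 1) +
        t * (shifted_Stirling m k t + (t + of_nat (Suc k)) * shifted_Stirling m (Suc k) t)"
      using Suc.IH[of l "t + 1"] Suc.IH[of k t] Suc by simp
    also have "\<dots> = (shifted_Stirling m l (t + 1) + t * shifted_Stirling m k t) +
        (t + of_nat (Suc k)) * (shifted_Stirling m k (t + 1) + t * shifted_Stirling m (Suc k) t)"
      by (simp add: algebra_simps)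
    finally show ?thesis using Suc by simp
  qed
qed

text \<open>At \<open>t = 1\<close>, splitting off the last variable becomes the recurrence of the
  Stirling numbers.\<close>

lemma shifted_Stirling_1: "shifted_Stirling m k 1 = of_nat (Stirling (Suc m) (Suc k))"
proof (induction m arbitrary: k)
  case 0
  show ?case by (cases k) auto
next
  case (Suc m)
  show ?case
  proof (cases k)
    case (Suc l)
    show ?thesis
      using Suc.IH[of l] Suc.IH[of "Suc l"] shifted_Stirling_rec[of m l 1]
      unfolding Suc Stirling.simps(4)[of "Suc m" "Suc l"] by (simp add: algebra_simps)
  qed (simp add: shifted_Stirling_0_right del: Stirling.simps)
qed

text \<open>Each of the \<open>m\<close> steps either shifts \<open>t\<close> to
  \<open>t + 1\<close> with factor \<open>2 + t\<close>, or multiplies by \<open>-t\<close>. Here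
  \<open>k\<close> counts the shifts: their factors form the Pochhammer symbol, and the other
  \<open>m - k\<close> factors are minus one of \<open>t, ..., t + k\<close>, which gives the
  complete homogeneous polynomial.\<close>

lemma config_weight_eq:
  "config_weight m n t = (\<Sum>k\<le>m. (-1) ^ (m + k) * shifted_Stirling m k t *
     pochhammer (t + 2) k * (t + of_nat k + 1) ^ n)"
proof (induction m arbitrary: t)
  case 0
  show ?case by (simp add: config_weight_0 add.commute)
next
  case (Suc m)
  let ?f = "\<lambda>m k t. (-1) ^ (m + k) * shifted_Stirling m k t * pochhammer (t + 2) k *
      (t + of_nat k + 1) ^ n"
  have f0: "?f (Suc m) 0 t = - t * ?f m 0 t" by simp
  have fS: "?f (Suc m) (Suc k) t = (2 + t) * ?f m k (1 + t) - t * ?f m (Suc k) t" for k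
  proof -
    have "pochhammer (t + 2) (Suc k) = (t + 2) * pochhammer (1 + t + 2) k"
      by (simp add: pochhammer_rec add.commute add.left_commute)
    then show ?thesis by (simp add: algebra_simps)
  qed
  have "(\<Sum>k\<le>Suc m. ?f (Suc m) k t) =
      - t * ?f m 0 t + (\<Sum>k\<le>m. (2 + t) * ?f m k (1 + t) - t * ?f m (Suc k) t)"
    unfolding sum.atMost_Suc_shift f0 fS ..
  also have "\<dots> = (2 + t) * (\<Sum>k\<le>m. ?f m k (1 + t)) - t * (\<Sum>k\<le>Suc m. ?f m k t)"
    unfolding sum.atMost_Suc_shift[of "\<lambda>k. ?f m k t"] sum_subtractf sum_distrib_left[symmetric]
    by (simp only: algebra_simps)
  also have "(\<Sum>k\<le>Suc m. ?f m k t) = (\<Sum>k\<le>m. ?f m k t)"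
    by (simp add: shifted_Stirling_eq_0)
  finally show ?case unfolding config_weight_Suc Suc.IH by simp
qed

lemma pochhammer_3: "pochhammer (3 :: rat) k = fact (k + 2) / 2"
  by (induction k) (auto simp: pochhammer_Suc field_simps)

text \<open>The coefficient of \<open>(k + 2) ^ n\<close> in the closed formula, with
  \<open>j = k + 2\<close>; the exponent \<open>m + k\<close> has the parity of
  \<open>m - j\<close>.\<close>

definition saturated_term :: "nat \<Rightarrow> nat \<Rightarrow> rat" where
  "saturated_term m k = (-1) ^ (m + k) * of_nat (Stirling (Suc m) (Suc k)) * fact (k + 2) / 2"

lemma card_configs:
  "of_nat (card (configs m n)) = (\<Sum>k\<le>m. saturated_term m k * of_nat (k + 2) ^ n)"
  unfolding config_weight_1[symmetric] config_weight_eq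
  by (intro sum.cong)
    (simp_all add: saturated_term_def shifted_Stirling_1 pochhammer_3 add.commute)


section \<open>Saturated transfer systems on a grid\<close>

text \<open>The grid is closed downwards, so letting \<open>w\<close> or \<open>v\<close> range over
  all pairs below a grid point agrees with ranging over subgroups.\<close>

definition grid_saturated :: "nat \<Rightarrow> nat \<Rightarrow> (nat \<times> nat) rel \<Rightarrow> bool" where
  "grid_saturated m n r \<longleftrightarrow>
     (\<forall>u v. (u, v) \<in> r \<longrightarrow> u \<in> grid m n \<and> v \<in> grid m n \<and> grid_le u v) \<and>
     (\<forall>u\<in>grid m n. (u, u) \<in> r) \<and> trans r \<and>
     (\<forall>u v w. (u, v) \<in> r \<longrightarrow> grid_le w v \<longrightarrow> (grid_meet u w, w) \<in> r) \<and>
     (\<forall>u w v. (u, w) \<in> r \<longrightarrow> grid_le u v \<longrightarrow> grid_le v w \<longrightarrow> (v, w) \<in> r)"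

text \<open>Restricting \<open>L \<rightarrow> H\<close> to an intermediate \<open>K\<close> gives
  \<open>L \<rightarrow> K\<close>. So two-out-of-three amounts, beyond transitivity and
  restriction, to \<open>L \<rightarrow> H\<close> implying
  \<open>K \<rightarrow> H\<close>.\<close>

lemma saturated_transfer_system_iff:
  "saturated_transfer_system G R \<longleftrightarrow>
     (\<forall>K H. (K, H) \<in> R \<longrightarrow> subgroup K G \<and> subgroup H G \<and> K \<subseteq> H) \<and>
     (\<forall>H. subgroup H G \<longrightarrow> (H, H) \<in> R) \<and> trans R \<and>
     (\<forall>K H. (K, H) \<in> R \<longrightarrow> (\<forall>M. subgroup M G \<longrightarrow> M \<subseteq> H \<longrightarrow> (K \<inter> M, M) \<in> R)) \<and>
     (\<forall>L H. (L, H) \<in> R \<longrightarrow> (\<forall>K. subgroup K G \<longrightarrow> L \<subseteq> K \<longrightarrow> K \<subseteq> H \<longrightarrow> (K, H) \<in> R))"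
    (is "_ \<longleftrightarrow> ?A \<and> ?B \<and> ?C \<and> ?D \<and> ?E")
proof
  assume sat: "saturated_transfer_system G R"
  then have T: "transfer_system G R" by (simp only: saturated_transfer_system_def)
  note T' = T[unfolded transfer_system_def]
  have A: ?A by (rule T'[THEN conjunct1])
  moreover have B: ?B
    using T'[THEN conjunct2, THEN conjunct1] by (auto intro: refl_onD)
  moreover have C: ?C by (rule T'[THEN conjunct2, THEN conjunct2, THEN conjunct1])
  moreover have D: ?D
    using T'[THEN conjunct2, THEN conjunct2, THEN conjunct2] by blast
  moreover have ?E
  proof (intro allI impI)
    fix L H K assume *: "(L, H) \<in> R" "subgroup K G" "L \<subseteq> K" "K \<subseteq> H"
    then have "(L \<inter> K, K) \<in> R" using D[rule_format, of L H K] by blast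
    moreover have "L \<inter> K = L" using * by blast
    ultimately have "(L, K) \<in> R" by simp
    moreover have "subgroup L G" "subgroup H G" using A *(1) by simp_all
    ultimately show "(K, H) \<in> R"
      using sat[unfolded saturated_transfer_system_def, THEN conjunct2, rule_format, of L K H] *
      by simp
  qed
  ultimately show "?A \<and> ?B \<and> ?C \<and> ?D \<and> ?E" by (intro conjI)
next
  assume *: "?A \<and> ?B \<and> ?C \<and> ?D \<and> ?E"
  from * have A: ?A by (elim conjE)
  from * have B: ?B by (elim conjE)
  from * have C: ?C by (elim conjE)
  from * have D: ?D by (elim conjE)
  from * have E: ?E by (elim conjE)
  have "transfer_system G R"
    unfolding transfer_system_def
  proof (intro conjI A C)
    show "refl_on {H. subgroup H G} R" using A B by (simp add: refl_on_def)
    show "\<forall>K H M. (K, H) \<in> R \<longrightarrow> subgroup M G \<longrightarrow> M \<subseteq> H \<longrightarrow> (K \<inter> M, M) \<in> R"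
      using D by simp
  qed
  moreover have "(L, K) \<in> R" if "subgroup K G" "L \<subseteq> K" "K \<subseteq> H" "(L, H) \<in> R" for L K H
  proof -
    have "(L \<inter> K, K) \<in> R" using D[rule_format, of L H K] that by simp
    moreover have "L \<inter> K = L" using that by blast
    ultimately show ?thesis by simp
  qed
  ultimately show "saturated_transfer_system G R"
    unfolding saturated_transfer_system_def
  proof (intro conjI allI impI; (elim conjE)?)
    fix L K H assume "subgroup K G" "L \<subseteq> K" "K \<subseteq> H" "(L, H) \<in> R"
    then show "(K, H) \<in> R" using E[rule_format, of L H K] by simp
  next
    fix L K H assume "(L, K) \<in> R" "(K, H) \<in> R"
    then show "(L, H) \<in> R" by (rule transD[OF C])
  qed
qed

text \<open>The defining clauses use only inclusion and intersection, so they can be moved along the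
  lattice isomorphism given by \<open>grid_subgroup\<close>.\<close>

lemma num_saturated_eq_card_grid:
  assumes pq: "prime p" "prime q" "p \<noteq> q"
  shows "num_saturated p q m n = card {r. grid_saturated m n r}"
proof -
  let ?G = "integer_mod_group (p ^ m * q ^ n)"
  define f where "f = grid_subgroup p q m n"
  have bij: "bij_betw f (grid m n) {H. subgroup H ?G}"
    unfolding f_def by (rule bij_grid_subgroup[OF pq])
  then have inj: "inj_on f (grid m n)" and im: "f ` grid m n = {H. subgroup H ?G}"
    by (simp_all add: bij_betw_def)
  have meet: "f u \<inter> f v = f (grid_meet u v)" for u v
    unfolding f_def by (rule grid_subgroup_meet[OF pq])
  have sub: "subgroup (f u) ?G" if "u \<in> grid m n" for u using im that by blast
  have ex: "\<exists>u\<in>grid m n. H = f u" if "subgroup H ?G" for H using im that by blast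
  have all: "(\<forall>H. subgroup H ?G \<longrightarrow> Q H) \<longleftrightarrow> (\<forall>u\<in>grid m n. Q (f u))" for Q
    by (metis ex sub)
  have f_eq: "f u = f v \<longleftrightarrow> u = v" if "u \<in> grid m n" "v \<in> grid m n" for u v
    using inj that by (auto dest: inj_onD)
  \<comment> \<open>Inclusion is recovered from intersection, so compatibility with meets and
    injectivity suffice.\<close>
  have le: "f u \<subseteq> f v \<longleftrightarrow> grid_le u v" if "u \<in> grid m n" "v \<in> grid m n" for u v
  proof -
    have "f u \<subseteq> f v \<longleftrightarrow> f (grid_meet u v) = f u"
      unfolding meet[symmetric] by blast
    then show ?thesis using that by (simp add: f_eq grid_meet_in_grid grid_le_iff_meet)
  qed
  have grid_le_grid: "u \<in> grid m n" if "grid_le u v" "v \<in> grid m n" for u v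
    using that by (cases u; cases v) (auto simp: grid_def grid_le_def)
  define pull where "pull R = {(u, v). u \<in> grid m n \<and> v \<in> grid m n \<and> (f u, f v) \<in> R}" for R
  have pull_iff: "(u, v) \<in> pull R \<longleftrightarrow> (f u, f v) \<in> R" if "u \<in> grid m n" "v \<in> grid m n" for u v R
    using that by (simp add: pull_def)
  have iff: "saturated_transfer_system ?G R \<longleftrightarrow> grid_saturated m n (pull R)"
    if R: "R \<subseteq> {H. subgroup H ?G} \<times> {H. subgroup H ?G}" for R
  proof -
    have R': "subgroup K ?G" "subgroup H ?G" if "(K, H) \<in> R" for K H using R that by auto
    have rel_all: "(\<forall>K H. (K, H) \<in> R \<longrightarrow> Q K H) \<longleftrightarrow> (\<forall>u v. (u, v) \<in> pull R \<longrightarrow> Q (f u) (f v))" for Q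
    proof
      assume *: "\<forall>u v. (u, v) \<in> pull R \<longrightarrow> Q (f u) (f v)"
      show "\<forall>K H. (K, H) \<in> R \<longrightarrow> Q K H"
      proof (intro allI impI)
        fix K H assume KH: "(K, H) \<in> R"
        then obtain u v where "u \<in> grid m n" "v \<in> grid m n" "K = f u" "H = f v"
          using ex R' by metis
        then show "Q K H" using *[rule_format, of u v] KH by (simp add: pull_iff)
      qed
    qed (simp add: pull_def)
    have 1: "(\<forall>K H. (K, H) \<in> R \<longrightarrow> subgroup K ?G \<and> subgroup H ?G \<and> K \<subseteq> H) \<longleftrightarrow>
        (\<forall>u v. (u, v) \<in> pull R \<longrightarrow> u \<in> grid m n \<and> v \<in> grid m n \<and> grid_le u v)"
      unfolding rel_all by (auto simp: pull_def sub le)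
    have 2: "(\<forall>H. subgroup H ?G \<longrightarrow> (H, H) \<in> R) \<longleftrightarrow> (\<forall>u\<in>grid m n. (u, u) \<in> pull R)"
      unfolding all by (simp add: pull_iff)
    have 3: "trans R \<longleftrightarrow> trans (pull R)"
    proof
      assume R: "trans R"
      show "trans (pull R)"
      proof (rule transI)
        fix u v w assume "(u, v) \<in> pull R" "(v, w) \<in> pull R"
        then show "(u, w) \<in> pull R" using transD[OF R, of "f u" "f v" "f w"] by (simp add: pull_def)
      qed
    next
      assume R: "trans (pull R)"
      show "trans R"
      proof (rule transI)
        fix K H L assume KHL: "(K, H) \<in> R" "(H, L) \<in> R"
        then obtain u v w where "u \<in> grid m n" "v \<in> grid m n" "w \<in> grid m n"
          "K = f u" "H = f v" "L = f w"
          using ex R' by metis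
        then show "(K, L) \<in> R" using transD[OF R, of u v w] KHL by (simp add: pull_iff)
      qed
    qed
    have 4: "(\<forall>K H. (K, H) \<in> R \<longrightarrow> (\<forall>M. subgroup M ?G \<longrightarrow> M \<subseteq> H \<longrightarrow> (K \<inter> M, M) \<in> R)) \<longleftrightarrow>
        (\<forall>u v w. (u, v) \<in> pull R \<longrightarrow> grid_le w v \<longrightarrow> (grid_meet u w, w) \<in> pull R)"
      unfolding rel_all all meet
    proof (intro all_cong1 iffI impI allI ballI)
      fix u v w assume "(u, v) \<in> pull R \<longrightarrow> (\<forall>w\<in>grid m n. f w \<subseteq> f v \<longrightarrow> (f (grid_meet u w), f w) \<in> R)"
        "(u, v) \<in> pull R" "grid_le w v"
      moreover from this have "u \<in> grid m n" "v \<in> grid m n" by (auto simp: pull_def)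
      moreover from this have "w \<in> grid m n" using \<open>grid_le w v\<close> grid_le_grid by blast
      ultimately show "(grid_meet u w, w) \<in> pull R"
        by (simp add: pull_iff le grid_meet_in_grid)
    next
      fix u v w assume *: "\<forall>w. (u, v) \<in> pull R \<longrightarrow> grid_le w v \<longrightarrow> (grid_meet u w, w) \<in> pull R"
        and uv: "(u, v) \<in> pull R" "w \<in> grid m n" "f w \<subseteq> f v"
      from uv have "u \<in> grid m n" "v \<in> grid m n" by (simp_all add: pull_def)
      then have "(grid_meet u w, w) \<in> pull R" using *[rule_format, of w] uv le by simp
      then show "(f (grid_meet u w), f w) \<in> R" by (simp add: pull_def)
    qed
    have 5: "(\<forall>L H. (L, H) \<in> R \<longrightarrow> (\<forall>K. subgroup K ?G \<longrightarrow> L \<subseteq> K \<longrightarrow> K \<subseteq> H \<longrightarrow> (K, H) \<in> R)) \<longleftrightarrow>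
        (\<forall>u w v. (u, w) \<in> pull R \<longrightarrow> grid_le u v \<longrightarrow> grid_le v w \<longrightarrow> (v, w) \<in> pull R)"
      unfolding rel_all all
    proof (intro all_cong1 iffI impI allI ballI)
      fix u w v assume "(u, w) \<in> pull R \<longrightarrow> (\<forall>v\<in>grid m n. f u \<subseteq> f v \<longrightarrow> f v \<subseteq> f w \<longrightarrow> (f v, f w) \<in> R)"
        "(u, w) \<in> pull R" "grid_le u v" "grid_le v w"
      moreover from this have "u \<in> grid m n" "w \<in> grid m n" by (auto simp: pull_def)
      moreover from this have "v \<in> grid m n" using \<open>grid_le v w\<close> grid_le_grid by blast
      ultimately show "(v, w) \<in> pull R" by (simp add: pull_iff le)
    next
      fix u w v assume *: "\<forall>v. (u, w) \<in> pull R \<longrightarrow> grid_le u v \<longrightarrow> grid_le v w \<longrightarrow> (v, w) \<in> pull R"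
        and uw: "(u, w) \<in> pull R" "v \<in> grid m n" "f u \<subseteq> f v" "f v \<subseteq> f w"
      from uw have "u \<in> grid m n" "w \<in> grid m n" by (simp_all add: pull_def)
      then have "(v, w) \<in> pull R" using *[rule_format, of v] uw le by simp
      then show "(f v, f w) \<in> R" by (simp add: pull_def)
    qed
    show ?thesis
      unfolding saturated_transfer_system_iff grid_saturated_def 1 2 3 4 5 ..
  qed
  have sat_sub: "R \<subseteq> {H. subgroup H ?G} \<times> {H. subgroup H ?G}"
    if "saturated_transfer_system ?G R" for R
    using that by (auto simp: saturated_transfer_system_iff)
  have "bij_betw pull {R. saturated_transfer_system ?G R} {r. grid_saturated m n r}"
  proof (rule bij_betw_byWitness[where f' = "\<lambda>r. map_prod f f ` r"])
    show "\<forall>R\<in>{R. saturated_transfer_system ?G R}. map_prod f f ` pull R = R"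
    proof
      fix R assume "R \<in> {R. saturated_transfer_system ?G R}"
      then have "R \<subseteq> {H. subgroup H ?G} \<times> {H. subgroup H ?G}" using sat_sub by simp
      then have R: "subgroup K ?G" "subgroup H ?G" if "(K, H) \<in> R" for K H using that by auto
      show "map_prod f f ` pull R = R"
      proof (intro equalityI subsetI)
        fix z assume z: "z \<in> R"
        obtain K H where KH: "z = (K, H)" by (cases z)
        then obtain u v where "u \<in> grid m n" "v \<in> grid m n" "K = f u" "H = f v"
          using ex R z by metis
        then have "(u, v) \<in> pull R" "z = map_prod f f (u, v)" using z KH by (simp_all add: pull_iff)
        then show "z \<in> map_prod f f ` pull R" by blast
      qed (auto simp: pull_def)
    qed
    have pull_push: "pull (map_prod f f ` r) = r" if r: "r \<subseteq> grid m n \<times> grid m n" for r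
    proof -
      have push: "(f u, f v) \<in> map_prod f f ` r \<longleftrightarrow> (u, v) \<in> r"
        if "u \<in> grid m n" "v \<in> grid m n" for u v
      proof
        assume "(f u, f v) \<in> map_prod f f ` r"
        then obtain u' v' where *: "(u', v') \<in> r" "f u = f u'" "f v = f v'" by auto
        then have "u' \<in> grid m n" "v' \<in> grid m n" using r by blast+
        then have "u = u'" "v = v'" using * that f_eq by blast+
        then show "(u, v) \<in> r" using * by simp
      qed force
      have "(u, v) \<in> pull (map_prod f f ` r) \<longleftrightarrow> (u, v) \<in> r" for u v
      proof (cases "u \<in> grid m n \<and> v \<in> grid m n")
        case True
        then show ?thesis using push by (simp only: pull_iff)
      next
        case False
        then have "(u, v) \<notin> r" using r by blast
        then show ?thesis using False by (auto simp: pull_def)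
      qed
      then show ?thesis by (intro equalityI subrelI) simp_all
    qed
    have sub_grid: "r \<subseteq> grid m n \<times> grid m n" if "grid_saturated m n r" for r
    proof (rule subrelI)
      fix u v assume "(u, v) \<in> r"
      then show "(u, v) \<in> grid m n \<times> grid m n"
        using that[unfolded grid_saturated_def, THEN conjunct1] by blast
    qed
    show "\<forall>r\<in>{r. grid_saturated m n r}. pull (map_prod f f ` r) = r"
      using pull_push sub_grid by simp
    show "pull ` {R. saturated_transfer_system ?G R} \<subseteq> {r. grid_saturated m n r}"
    proof (rule image_subsetI)
      fix R assume "R \<in> {R. saturated_transfer_system ?G R}"
      then show "pull R \<in> {r. grid_saturated m n r}" using iff[OF sat_sub, of R] by simp
    qed
    show "(\<lambda>r. map_prod f f ` r) ` {r. grid_saturated m n r} \<subseteq>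
        {R. saturated_transfer_system ?G R}"
    proof (rule image_subsetI)
      fix r assume r: "r \<in> {r. grid_saturated m n r}"
      then have "r \<subseteq> grid m n \<times> grid m n" using sub_grid by simp
      then have "map_prod f f ` r \<subseteq> {H. subgroup H ?G} \<times> {H. subgroup H ?G}"
        using sub by auto
      then show "map_prod f f ` r \<in> {R. saturated_transfer_system ?G R}"
        using iff[of "map_prod f f ` r"] pull_push sub_grid r by simp
    qed
  qed
  then show ?thesis unfolding num_saturated_def by (rule bij_betw_same_card)
qed

text \<open>By restriction it suffices to ask for the edges along the top and the right side of the
  rectangle spanned by the two points.\<close>

definition rel_of_config :: "nat \<Rightarrow> nat \<Rightarrow> nat list \<times> nat set list \<Rightarrow> (nat \<times> nat) rel" where
  "rel_of_config m n = (\<lambda>(as, Vs). {((x, y), (x', y')). x \<le> x' \<and> x' \<le> m \<and> y \<le> y' \<and> y' \<le> n \<and>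
     (\<forall>i. x \<le> i \<and> i < x' \<longrightarrow> y' < as ! i) \<and> (\<forall>j. y < j \<and> j \<le> y' \<longrightarrow> j \<in> Vs ! x')})"

text \<open>A count can serve as threshold because restriction makes the heights of horizontal edges
  an initial segment. The \<open>j - 1\<close> reflects naming a vertical edge by its upper
  end.\<close>

definition config_of_rel :: "nat \<Rightarrow> nat \<Rightarrow> (nat \<times> nat) rel \<Rightarrow> nat list \<times> nat set list" where
  "config_of_rel m n r =
     (map (\<lambda>x. card {y. y \<le> n \<and> ((x, y), (Suc x, y)) \<in> r}) [0..<m],
      map (\<lambda>x. {j \<in> {1..n}. ((x, j - 1), (x, j)) \<in> r}) [0..<Suc m])"

lemma down_closed_eq_lessThan_card:
  fixes D :: "nat set"
  assumes "finite D" "\<And>x y. x \<in> D \<Longrightarrow> y \<le> x \<Longrightarrow> y \<in> D"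
  shows "D = {..<card D}"
proof -
  have "D \<subseteq> {..<card D}"
  proof
    fix x assume "x \<in> D"
    then have "{..x} \<subseteq> D" using assms(2) by blast
    then have "card {..x} \<le> card D" by (rule card_mono[OF assms(1)])
    then show "x \<in> {..<card D}" by simp
  qed
  then show ?thesis by (intro card_subset_eq) simp_all
qed

text \<open>Transitivity is the substantial clause: the top side of the first rectangle must be
  lifted to the height of the second, and its right side moved to the column of the second.\<close>

lemma grid_saturated_rel_of_config:
  assumes "c \<in> configs m n"
  shows "grid_saturated m n (rel_of_config m n c)"
proof -
  obtain as Vs where c: "c = (as, Vs)" by (cases c)
  have Vs: "Vs ! x \<subseteq> {1..n}" if "x \<le> m" for x
    using assms that by (simp add: c configs_def)
  have step: "col_step (as ! x) (Vs ! x) (Vs ! Suc x)" if "x < m" for x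
    using assms that by (simp add: c configs_def)
  have anti: "Vs ! x' \<subseteq> Vs ! x" if "x \<le> x'" "x' \<le> m" for x x'
    using that
  proof (induction x' rule: dec_induct)
    case (step x')
    have "Vs ! Suc x' \<subseteq> Vs ! x'"
      using \<open>\<And>x. x < m \<Longrightarrow> col_step (as ! x) (Vs ! x) (Vs ! Suc x)\<close> step.prems
      by (auto simp: col_step_def)
    then show ?case using step by auto
  qed simp
  let ?r = "rel_of_config m n c"
  have iff: "((x, y), (x', y')) \<in> ?r \<longleftrightarrow> x \<le> x' \<and> x' \<le> m \<and> y \<le> y' \<and> y' \<le> n \<and>
     (\<forall>i. x \<le> i \<and> i < x' \<longrightarrow> y' < as ! i) \<and> (\<forall>j. y < j \<and> j \<le> y' \<longrightarrow> j \<in> Vs ! x')" for x y x' y'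
    by (simp add: rel_of_config_def c)
  have "trans ?r"
  proof (rule transI)
    fix u v w assume "(u, v) \<in> ?r" "(v, w) \<in> ?r"
    moreover obtain x y x1 y1 x2 y2 where uvw: "u = (x, y)" "v = (x1, y1)" "w = (x2, y2)"
      by (metis prod.exhaust)
    ultimately have 1: "x \<le> x1" "y \<le> y1" "\<And>i. x \<le> i \<Longrightarrow> i < x1 \<Longrightarrow> y1 < as ! i"
        "\<And>j. y < j \<Longrightarrow> j \<le> y1 \<Longrightarrow> j \<in> Vs ! x1"
      and 2: "x1 \<le> x2" "x2 \<le> m" "y1 \<le> y2" "y2 \<le> n" "\<And>i. x1 \<le> i \<Longrightarrow> i < x2 \<Longrightarrow> y2 < as ! i"
        "\<And>j. y1 < j \<Longrightarrow> j \<le> y2 \<Longrightarrow> j \<in> Vs ! x2"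
      by (auto simp: iff)
    \<comment> \<open>Climb from \<open>y1\<close> to \<open>y2\<close>. The vertical edge ending at
      \<open>Suc j\<close> lies in column \<open>x2\<close>, hence in column \<open>Suc i\<close>,
      so \<open>Suc j\<close> differs from the threshold and stays below it.\<close>
    have a: "y2 < as ! i" if i: "x \<le> i" "i < x1" for i
    proof -
      have "j \<le> y2 \<longrightarrow> j < as ! i" if "y1 \<le> j" for j
        using that
      proof (induction j rule: dec_induct)
        case base
        then show ?case using 1(3)[OF i] by simp
      next
        case (step j)
        show ?case
        proof
          assume j: "Suc j \<le> y2"
          then have "Suc j \<in> Vs ! x2" using 2(6) step by simp
          then have "Suc j \<in> Vs ! Suc i" using anti[of "Suc i" x2] i 2(1,2) by auto
          then have "Suc j \<noteq> as ! i"
            using \<open>\<And>x. x < m \<Longrightarrow> col_step (as ! x) (Vs ! x) (Vs ! Suc x)\<close>[of i] i 2(1,2)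
            by (auto simp: col_step_def)
          then show "Suc j < as ! i" using step j by simp
        qed
      qed
      then show ?thesis using 2(3) by simp
    qed
    \<comment> \<open>Move right from \<open>x1\<close> to \<open>x2\<close>. Every threshold passed
      exceeds \<open>y2\<close>, hence \<open>j\<close>, so the vertical edge survives each
      step.\<close>
    have b: "j \<in> Vs ! x2" if j: "y < j" "j \<le> y1" for j
    proof -
      have "i \<le> x2 \<longrightarrow> j \<in> Vs ! i" if "x1 \<le> i" for i
        using that
      proof (induction i rule: dec_induct)
        case base
        then show ?case using 1(4)[OF j] by simp
      next
        case (step i)
        show ?case
        proof
          assume i: "Suc i \<le> x2"
          then have "j < as ! i" using 2(5)[of i] step 2(3) j by simp
          moreover have "j \<in> Vs ! i" using step i by simp
          ultimately show "j \<in> Vs ! Suc i"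
            using \<open>\<And>x. x < m \<Longrightarrow> col_step (as ! x) (Vs ! x) (Vs ! Suc x)\<close>[of i] i 2(2) j
            by (auto simp: col_step_def)
        qed
      qed
      then show ?thesis using 2(1) by simp
    qed
    show "(u, w) \<in> ?r"
      unfolding uvw iff using 1 2 a b by (meson le_trans not_le)
  qed
  moreover have "(grid_meet u w, w) \<in> ?r" if "(u, v) \<in> ?r" "grid_le w v" for u v w
  proof -
    obtain x y x1 y1 x2 y2 where uvw: "u = (x, y)" "v = (x1, y1)" "w = (x2, y2)"
      by (metis prod.exhaust)
    have *: "x1 \<le> m" "y1 \<le> n" "\<And>i. x \<le> i \<Longrightarrow> i < x1 \<Longrightarrow> y1 < as ! i"
        "\<And>j. y < j \<Longrightarrow> j \<le> y1 \<Longrightarrow> j \<in> Vs ! x1" "x2 \<le> x1" "y2 \<le> y1"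
      using that by (auto simp: uvw iff grid_le_def)
    have "y2 < as ! i" if "min x x2 \<le> i" "i < x2" for i
      using *(3)[of i] *(5,6) that by (simp add: min_def split: if_splits)
    moreover have "j \<in> Vs ! x2" if "min y y2 < j" "j \<le> y2" for j
      using *(4)[of j] *(1,5,6) that anti[of x2 x1] by (auto simp: min_def split: if_splits)
    ultimately show ?thesis using * by (simp add: uvw iff grid_meet_def)
  qed
  moreover have "(v, w) \<in> ?r" if "(u, w) \<in> ?r" "grid_le u v" "grid_le v w" for u v w
    using that by (cases u; cases v; cases w) (auto simp: iff grid_le_def)
  ultimately show ?thesis
    unfolding grid_saturated_def by (auto simp: iff grid_le_def grid_def)
qed

text \<open>The step conditions come from unit squares; the relation is recovered because
  restriction and saturation reduce it to unit edges.\<close>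

lemma config_of_rel_in_configs:
  assumes "grid_saturated m n r"
  shows "config_of_rel m n r \<in> configs m n \<and> rel_of_config m n (config_of_rel m n r) = r"
proof -
  have in_grid: "x \<le> x'" "x' \<le> m" "y \<le> y'" "y' \<le> n" if "((x, y), (x', y')) \<in> r" for x y x' y'
  proof -
    have "(x, y) \<in> grid m n \<and> (x', y') \<in> grid m n \<and> grid_le (x, y) (x', y')"
      using assms that unfolding grid_saturated_def by blast
    then show "x \<le> x'" "x' \<le> m" "y \<le> y'" "y' \<le> n"
      by (simp_all add: grid_def grid_le_def)
  qed
  have refl: "((x, y), (x, y)) \<in> r" if "x \<le> m" "y \<le> n" for x y
    using assms that by (simp add: grid_saturated_def grid_def)
  have tr: "(u, w) \<in> r" if "(u, v) \<in> r" "(v, w) \<in> r" for u v w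
    using assms that unfolding grid_saturated_def by (blast dest: transD)
  have res: "((min x x2, min y y2), (x2, y2)) \<in> r"
    if "((x, y), (x1, y1)) \<in> r" "x2 \<le> x1" "y2 \<le> y1" for x y x1 y1 x2 y2
  proof -
    have "(grid_meet (x, y) (x2, y2), (x2, y2)) \<in> r"
      using assms[unfolded grid_saturated_def, THEN conjunct2, THEN conjunct2, THEN conjunct2,
        THEN conjunct1, rule_format, of "(x, y)" "(x1, y1)" "(x2, y2)"] that
      by (simp add: grid_le_def)
    then show ?thesis by (simp add: grid_meet_def)
  qed
  have sat: "((x1, y1), (x2, y2)) \<in> r"
    if "((x, y), (x2, y2)) \<in> r" "x \<le> x1" "x1 \<le> x2" "y \<le> y1" "y1 \<le> y2" for x y x1 y1 x2 y2
    using assms[unfolded grid_saturated_def, THEN conjunct2, THEN conjunct2, THEN conjunct2,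
      THEN conjunct2, rule_format, of "(x, y)" "(x2, y2)" "(x1, y1)"] that
    by (simp add: grid_le_def)
  define a where "a x = card {y. y \<le> n \<and> ((x, y), (Suc x, y)) \<in> r}" for x
  define V where "V x = {j \<in> {1..n}. ((x, j - 1), (x, j)) \<in> r}" for x
  have c: "config_of_rel m n r = (map a [0..<m], map V [0..<Suc m])"
    unfolding config_of_rel_def a_def[abs_def] V_def[abs_def] ..
  have h: "((x, y), (Suc x, y)) \<in> r \<longleftrightarrow> y < a x" for x y
  proof -
    have "{y. y \<le> n \<and> ((x, y), (Suc x, y)) \<in> r} = {..<a x}"
      unfolding a_def
    proof (rule down_closed_eq_lessThan_card)
      fix y y' assume "y \<in> {y. y \<le> n \<and> ((x, y), (Suc x, y)) \<in> r}" "y' \<le> y"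
      then show "y' \<in> {y. y \<le> n \<and> ((x, y), (Suc x, y)) \<in> r}"
        using res[of x y "Suc x" y "Suc x" y'] by simp
    qed simp
    then have "((x, y), (Suc x, y)) \<in> r \<and> y \<le> n \<longleftrightarrow> y < a x" by (auto simp: set_eq_iff)
    then show ?thesis using in_grid(4)[of x y "Suc x" y] by blast
  qed
  have a_le: "a x \<le> Suc n" for x
    using card_mono[of "{..n}" "{y. y \<le> n \<and> ((x, y), (Suc x, y)) \<in> r}"] by (simp add: a_def subset_eq)
  have v: "((x, j), (x, Suc j)) \<in> r \<longleftrightarrow> Suc j \<in> V x" for x j
    using in_grid(4)[of x j x "Suc j"] by (auto simp: V_def)
  have V_sub: "V x \<subseteq> {1..n}" for x by (auto simp: V_def)
  have V_Suc: "V (Suc x) \<subseteq> V x" for x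
  proof
    fix k assume "k \<in> V (Suc x)"
    then obtain j where j: "k = Suc j" "Suc j \<in> V (Suc x)" using V_sub[of "Suc x"] by (cases k) auto
    then have "((Suc x, j), (Suc x, Suc j)) \<in> r" using v by simp
    then have "((x, j), (x, Suc j)) \<in> r"
      using res[of "Suc x" j "Suc x" "Suc j" x "Suc j"] by simp
    then show "k \<in> V x" using v j by simp
  qed
  have step: "col_step (a x) (V x) (V (Suc x))" if x: "x < m" for x
    unfolding col_step_def
  proof (intro conjI V_Suc subsetI notI)
    fix k assume k: "k \<in> V x \<inter> {1..<a x}"
    then obtain j where j: "k = Suc j" by (cases k) auto
    \<comment> \<open>Left and top edges compose to the diagonal, and saturation then yields the
      right edge.\<close>
    have "((x, j), (x, Suc j)) \<in> r" "((x, Suc j), (Suc x, Suc j)) \<in> r"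
      using k j v h by auto
    then have "((x, j), (Suc x, Suc j)) \<in> r" by (rule tr)
    then have "((Suc x, j), (Suc x, Suc j)) \<in> r" by (rule sat) simp_all
    then show "k \<in> V (Suc x)" using v j by simp
  next
    assume k: "a x \<in> V (Suc x)"
    then obtain j where j: "a x = Suc j" using V_sub[of "Suc x"] by (cases "a x") auto
    \<comment> \<open>Bottom and right edges compose to the diagonal; saturation would yield the top
      edge at height \<open>a x\<close>, where there is none.\<close>
    have "((x, j), (Suc x, j)) \<in> r" "((Suc x, j), (Suc x, Suc j)) \<in> r"
      using k j v h by auto
    then have "((x, j), (Suc x, Suc j)) \<in> r" by (rule tr)
    then have "((x, Suc j), (Suc x, Suc j)) \<in> r" by (rule sat) simp_all
    then show False using h j by simp
  qed
  have "config_of_rel m n r \<in> configs m n"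
    unfolding c configs_def using a_le V_sub step by (simp del: upt_Suc)
  moreover have "((x, y), (x', y')) \<in> rel_of_config m n (config_of_rel m n r) \<longleftrightarrow>
      ((x, y), (x', y')) \<in> r" for x y x' y'
  proof
    assume r: "((x, y), (x', y')) \<in> r"
    have "y' < a i" if "x \<le> i" "i < x'" for i
    proof -
      have "((i, y'), (x', y')) \<in> r" using r by (rule sat) (use that in_grid[OF r] in auto)
      then have "((i, y'), (Suc i, y')) \<in> r"
        using res[of i y' x' y' "Suc i" y'] that by simp
      then show ?thesis using h by simp
    qed
    moreover have "j \<in> V x'" if "y < j" "j \<le> y'" for j
    proof -
      have "j \<noteq> 0" using that by simp
      then obtain k where k: "j = Suc k" by (cases j) auto
      have "((x', k), (x', y')) \<in> r" using r by (rule sat) (use that k in_grid[OF r] in auto)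
      then have "((x', k), (x', Suc k)) \<in> r"
        using res[of x' k x' y' x' "Suc k"] that k by simp
      then show ?thesis using v k by simp
    qed
    ultimately show "((x, y), (x', y')) \<in> rel_of_config m n (config_of_rel m n r)"
      using in_grid[OF r] by (auto simp: rel_of_config_def c simp del: upt_Suc)
  next
    assume "((x, y), (x', y')) \<in> rel_of_config m n (config_of_rel m n r)"
    then have *: "x \<le> x'" "x' \<le> m" "y \<le> y'" "y' \<le> n" "\<And>i. x \<le> i \<Longrightarrow> i < x' \<Longrightarrow> y' < a i"
      "\<And>j. y < j \<Longrightarrow> j \<le> y' \<Longrightarrow> j \<in> V x'"
      by (auto simp: rel_of_config_def c simp del: upt_Suc)
    have "i \<le> x' \<longrightarrow> ((x, y'), (i, y')) \<in> r" if "x \<le> i" for i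
      using that
    proof (induction i rule: dec_induct)
      case (step i)
      then show ?case using tr[of "(x, y')" "(i, y')" "(Suc i, y')"] h *(5)[of i] by simp
    qed (use refl * in simp)
    then have 1: "((x, y'), (x', y')) \<in> r" using *(1) by simp
    have "j \<le> y' \<longrightarrow> ((x', y), (x', j)) \<in> r" if "y \<le> j" for j
      using that
    proof (induction j rule: dec_induct)
      case (step j)
      then show ?case using tr[of "(x', y)" "(x', j)" "(x', Suc j)"] v *(6)[of "Suc j"] by simp
    qed (use refl * in simp)
    then have "((x', y), (x', y')) \<in> r" using *(3) by simp
    \<comment> \<open>Restricting the right side of the rectangle to column \<open>x\<close> gives
      its left side, which composes with the top side.\<close>
    then have "((x, y), (x, y')) \<in> r"
      using res[of x' y x' y' x y'] * by (simp add: min_absorb2)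
    then show "((x, y), (x', y')) \<in> r" using 1 tr by blast
  qed
  ultimately show ?thesis by auto
qed

lemma config_of_rel_of_config:
  assumes "c \<in> configs m n"
  shows "config_of_rel m n (rel_of_config m n c) = c"
proof -
  obtain as Vs where c: "c = (as, Vs)" by (cases c)
  have len: "length as = m" "length Vs = Suc m" using assms by (simp_all add: c configs_def)
  have "as ! x = card {y. y \<le> n \<and> ((x, y), (Suc x, y)) \<in> rel_of_config m n c}" if "x < m" for x
  proof -
    have "as ! x \<le> Suc n" using assms that by (simp add: c configs_def)
    then have "{y. y \<le> n \<and> ((x, y), (Suc x, y)) \<in> rel_of_config m n c} = {..<as ! x}"
      using that by (auto simp: rel_of_config_def c less_Suc_eq)
    then show ?thesis by simp
  qed
  moreover have "Vs ! x = {j \<in> {1..n}. ((x, j - 1), (x, j)) \<in> rel_of_config m n c}" if "x \<le> m" for x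
  proof -
    have V: "Vs ! x \<subseteq> {1..n}" using assms that by (simp add: c configs_def)
    have "((x, j - 1), (x, j)) \<in> rel_of_config m n c \<longleftrightarrow> j \<in> Vs ! x" if j: "j \<in> {1..n}" for j
    proof -
      have "i = j" if "j - 1 < i" "i \<le> j" for i using that j by simp
      then show ?thesis using j \<open>x \<le> m\<close> by (auto simp: rel_of_config_def c)
    qed
    then show ?thesis using V by blast
  qed
  ultimately show ?thesis
    by (auto simp: config_of_rel_def c len less_Suc_eq_le intro!: nth_equalityI simp del: upt_Suc)
qed

lemma card_grid_saturated: "card {r. grid_saturated m n r} = card (configs m n)"
proof (rule bij_betw_same_card)
  show "bij_betw (config_of_rel m n) {r. grid_saturated m n r} (configs m n)"
  proof (rule bij_betw_byWitness[where f' = "rel_of_config m n"])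
    show "\<forall>r\<in>{r. grid_saturated m n r}. rel_of_config m n (config_of_rel m n r) = r"
      using config_of_rel_in_configs by blast
    show "\<forall>c\<in>configs m n. config_of_rel m n (rel_of_config m n c) = c"
      using config_of_rel_of_config by blast
    show "config_of_rel m n ` {r. grid_saturated m n r} \<subseteq> configs m n"
      using config_of_rel_in_configs by (simp add: image_subset_iff)
    show "rel_of_config m n ` configs m n \<subseteq> {r. grid_saturated m n r}"
      using grid_saturated_rel_of_config by (simp add: image_subset_iff)
  qed
qed


section \<open>The exponential generating function\<close>

lemma saturated_term_Suc_0: "saturated_term (Suc m) 0 = - saturated_term m 0"
  by (simp add: saturated_term_def del: Stirling.simps)

lemma saturated_term_Suc_Suc:
  "saturated_term (Suc m) (Suc k) =
     of_nat (k + 3) * saturated_term m k - of_nat (k + 2) * saturated_term m (Suc k)"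
proof -
  define X Y F :: rat where "X = of_nat (Stirling (Suc m) (Suc (Suc k)))"
    and "Y = of_nat (Stirling (Suc m) (Suc k))" and "F = fact (k + 2)"
  have "fact (Suc k + 2) = of_nat (k + 3) * F"
    by (simp add: F_def algebra_simps)
  moreover have "of_nat (Stirling (Suc (Suc m)) (Suc (Suc k))) = of_nat (k + 2) * X + Y"
    unfolding Stirling.simps(4)[of "Suc m" "Suc k"] X_def Y_def
    by (simp add: algebra_simps del: Stirling.simps)
  ultimately have *:
    "saturated_term (Suc m) (Suc k) =
       (-1) ^ (Suc m + Suc k) * (of_nat (k + 2) * X + Y) * (of_nat (k + 3) * F) / 2"
    "saturated_term m (Suc k) = (-1) ^ (m + Suc k) * X * (of_nat (k + 3) * F) / 2"
    "saturated_term m k = (-1) ^ (m + k) * Y * F / 2"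
    unfolding saturated_term_def by (simp_all only: X_def Y_def F_def)
  show ?thesis unfolding * by (simp add: field_simps)
qed

lemma saturated_term_eq_0: "m < k \<Longrightarrow> saturated_term m k = 0"
  by (simp add: saturated_term_def del: Stirling.simps)

text \<open>The recurrence of \<open>saturated_term\<close> produces \<open>(k + 3) ^ Suc n\<close>
  and \<open>(k + 1) * (k + 2) ^ n\<close>. Expanding \<open>k + 3\<close> as
  \<open>(k + 2) + 1\<close> by the binomial theorem and writing \<open>k + 1\<close> as
  \<open>(k + 2) - 1\<close> returns to powers of \<open>k + 2\<close>.\<close>

lemma saturated_sum_Suc:
  defines "s \<equiv> \<lambda>m n. \<Sum>k\<le>m. saturated_term m k * of_nat (k + 2) ^ n"
  shows "s (Suc m) n = s m n + (\<Sum>i\<le>Suc n. of_nat (Suc n choose i) * s m i) - s m (Suc n)"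
proof -
  let ?T = saturated_term
  have "s (Suc m) n = ?T (Suc m) 0 * 2 ^ n + (\<Sum>k\<le>m. ?T (Suc m) (Suc k) * of_nat (k + 3) ^ n)"
    unfolding s_def sum.atMost_Suc_shift by (simp add: numeral_3_eq_3)
  also have "\<dots> = (\<Sum>k\<le>m. ?T m k * of_nat (k + 3) ^ Suc n) -
      (?T m 0 * 2 ^ n + (\<Sum>k\<le>m. of_nat (k + 2) * ?T m (Suc k) * of_nat (k + 3) ^ n))"
  proof -
    have "(\<Sum>k\<le>m. ?T (Suc m) (Suc k) * of_nat (k + 3) ^ n) =
        (\<Sum>k\<le>m. ?T m k * of_nat (k + 3) ^ Suc n) -
        (\<Sum>k\<le>m. of_nat (k + 2) * ?T m (Suc k) * of_nat (k + 3) ^ n)"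
      unfolding saturated_term_Suc_Suc sum_subtractf[symmetric]
      by (intro sum.cong) (simp_all only: power_Suc algebra_simps)
    then show ?thesis unfolding saturated_term_Suc_0 by simp
  qed
  also have "?T m 0 * 2 ^ n + (\<Sum>k\<le>m. of_nat (k + 2) * ?T m (Suc k) * of_nat (k + 3) ^ n) =
      (\<Sum>k\<le>Suc m. of_nat (k + 1) * ?T m k * of_nat (k + 2) ^ n)"
    unfolding sum.atMost_Suc_shift by (simp add: numeral_3_eq_3)
  also have "\<dots> = (\<Sum>k\<le>m. of_nat (k + 1) * ?T m k * of_nat (k + 2) ^ n)"
    by (simp add: saturated_term_eq_0)
  also have "(\<Sum>k\<le>m. ?T m k * of_nat (k + 3) ^ Suc n) - \<dots> =
      (\<Sum>k\<le>m. ?T m k * of_nat (k + 2) ^ n + ?T m k * of_nat (k + 3) ^ Suc n -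
        ?T m k * of_nat (k + 2) ^ Suc n)"
    unfolding sum_subtractf[symmetric] by (intro sum.cong) (simp_all add: algebra_simps)
  also have "(\<Sum>k\<le>m. ?T m k * of_nat (k + 2) ^ n + ?T m k * of_nat (k + 3) ^ Suc n -
        ?T m k * of_nat (k + 2) ^ Suc n) =
      s m n + (\<Sum>k\<le>m. ?T m k * of_nat (k + 3) ^ Suc n) - s m (Suc n)"
    unfolding s_def by (simp only: sum.distrib sum_subtractf)
  also have "(\<Sum>k\<le>m. ?T m k * of_nat (k + 3) ^ Suc n) =
      (\<Sum>k\<le>m. \<Sum>i\<le>Suc n. of_nat (Suc n choose i) * (?T m k * of_nat (k + 2) ^ i))"
  proof (rule sum.cong)
    fix k
    have "of_nat (k + 3) ^ Suc n = (of_nat (k + 2) + 1 :: rat) ^ Suc n"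
      by (simp add: add.commute)
    also have "\<dots> = (\<Sum>i\<le>Suc n. of_nat (Suc n choose i) * of_nat (k + 2) ^ i)"
      unfolding binomial_ring by (simp only: power_one mult_1_right)
    finally show "?T m k * of_nat (k + 3) ^ Suc n =
        (\<Sum>i\<le>Suc n. of_nat (Suc n choose i) * (?T m k * of_nat (k + 2) ^ i))"
      by (simp only: sum_distrib_left mult.left_commute)
  qed simp
  also have "\<dots> = (\<Sum>i\<le>Suc n. of_nat (Suc n choose i) * s m i)"
    unfolding s_def sum_distrib_left by (rule sum.swap)
  finally show ?thesis .
qed

lemma saturated_sum_0: "(\<Sum>k\<le>0. saturated_term 0 k * of_nat (k + 2) ^ n) = 2 ^ n"
  by (simp add: saturated_term_def)

text \<open>Reindexing by \<open>j = k + 2\<close>. The exponent \<open>m - j\<close> goes down to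
  \<open>-2\<close>, hence the integer power.\<close>

lemma saturated_sum_eq:
  "(\<Sum>k\<le>m. saturated_term m k * of_nat (k + 2) ^ n) =
     (\<Sum>j = 2..m + 2. (-1) powi (int m - int j) * of_nat (Stirling (m + 1) (j - 1)) *
               (fact j / 2) * of_nat j ^ n)"
proof -
  have sgn: "(-1 :: rat) powi (int m - int (k + 2)) = (-1) ^ (m + k)" for k
  proof -
    have "(-1 :: rat) powi (int m - int (k + 2)) = (-1) ^ m / (-1) ^ (k + 2)"
      by (subst power_int_diff) (simp_all only: power_int_of_nat, simp)
    then show ?thesis by (simp add: power_add field_simps minus_one_power_iff)
  qed
  have "(\<Sum>j = 0 + 2..m + 2. (-1) powi (int m - int j) * of_nat (Stirling (m + 1) (j - 1)) *
               (fact j / 2) * of_nat j ^ n) =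
      (\<Sum>k = 0..m. (-1) powi (int m - int (k + 2)) * of_nat (Stirling (m + 1) (k + 2 - 1)) *
               (fact (k + 2) / 2) * of_nat (k + 2) ^ n :: rat)"
    by (rule sum.shift_bounds_cl_nat_ivl)
  also have "\<dots> = (\<Sum>k\<le>m. saturated_term m k * of_nat (k + 2) ^ n)"
    unfolding sgn atMost_atLeast0 saturated_term_def by (intro sum.cong) simp_all
  finally show ?thesis unfolding add_0 ..
qed

section \<open>Partial derivatives and exponentials of series in two variables\<close>

definition deriv_x :: "fps2 \<Rightarrow> fps2" where
  "deriv_x F = Abs_fps (\<lambda>n. fps_deriv (fps_nth F n))"

lemma deriv_x_nth [simp]: "fps_nth (deriv_x F) n = fps_deriv (fps_nth F n)"
  by (simp add: deriv_x_def)

lemma deriv_x_add: "deriv_x (F + G) = deriv_x F + deriv_x G"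
  by (simp add: fps_eq_iff)

lemma deriv_x_diff: "deriv_x (F - G) = deriv_x F - deriv_x G"
  by (simp add: fps_eq_iff)

lemma deriv_x_mult: "deriv_x (F * G) = deriv_x F * G + F * deriv_x G"
proof (rule fps_ext)
  fix n
  show "fps_nth (deriv_x (F * G)) n = fps_nth (deriv_x F * G + F * deriv_x G) n"
    by (simp add: fps_mult_nth fps_deriv_sum sum.distrib add.commute)
qed

text \<open>The power is homogeneous of degree \<open>k\<close>, so in the truncated sum defining
  \<open>fps2_exp\<close> only its last term survives.\<close>

lemma linear_power_nth:
  fixes a b :: rat
  shows "fps_nth (fps_nth ((fps_const (fps_const a) * var_x + fps_const (fps_const b) * var_y) ^ k) n) m =
    (if k = m + n then of_nat (k choose n) * a ^ m * b ^ n else 0)"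
proof -
  have "(fps_const (fps_const a) * var_x + fps_const (fps_const b) * var_y) ^ k =
      (fps_const (fps_const b) * fps_X + fps_const (fps_const a * fps_X)) ^ k"
    by (simp add: var_x_def var_y_def add.commute)
  also have "\<dots> = (\<Sum>i\<le>k. of_nat (k choose i) * (fps_const (fps_const b) * fps_X) ^ i *
      fps_const (fps_const a * fps_X) ^ (k - i))"
    by (rule binomial_ring)
  also have "\<dots> = (\<Sum>i\<le>k. fps_const (of_nat (k choose i) * fps_const b ^ i *
      (fps_const a * fps_X) ^ (k - i)) * fps_X ^ i)"
    by (intro sum.cong) (simp_all add: power_mult_distrib fps_const_power fps_of_nat[symmetric] mult_ac)
  finally have *: "(fps_const (fps_const a) * var_x + fps_const (fps_const b) * var_y) ^ k =
      (\<Sum>i\<le>k. fps_const (of_nat (k choose i) * fps_const b ^ i *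
        (fps_const a * fps_X) ^ (k - i)) * fps_X ^ i)" .
  have "fps_nth ((fps_const (fps_const a) * var_x + fps_const (fps_const b) * var_y) ^ k) n =
     (\<Sum>i\<le>k. if i = n then of_nat (k choose n) * fps_const b ^ n * (fps_const a * fps_X) ^ (k - n) else 0)"
    unfolding * fps_sum_nth
    by (intro sum.cong) (auto simp: fps_X_power_nth simp del: fps_const_mult fps_const_power)
  also have "\<dots> = (if n \<le> k then fps_const (of_nat (k choose n) * b ^ n * a ^ (k - n)) * fps_X ^ (k - n) else 0)"
    by (simp add: power_mult_distrib fps_const_power fps_of_nat[symmetric] mult_ac)
  finally show ?thesis by (auto simp: fps_X_power_nth mult_ac)
qed

text \<open>This is \<open>exp (a x) * exp (b y)\<close> sorted by powers of \<open>y\<close>; all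
  exponentials of the theorem are instances.\<close>

lemma fps2_exp_linear:
  fixes a b :: rat
  shows "fps2_exp (fps_const (fps_const a) * var_x + fps_const (fps_const b) * var_y) =
    Abs_fps (\<lambda>n. fps_const (b ^ n / fact n) * fps_exp a)"
  unfolding fps2_exp_def linear_power_nth
  by (simp add: fps_eq_iff if_distrib[of "\<lambda>x. x / _"] binomial_fact cong: if_cong)

lemma fps2_exp_x: "fps2_exp var_x = fps_const (fps_exp 1)"
  using fps2_exp_linear[of 1 0] by (simp add: fps_eq_iff power_0_left)

lemma fps2_exp_y: "fps2_exp var_y = Abs_fps (\<lambda>n. fps_const (1 / fact n))"
  using fps2_exp_linear[of 0 1] by simp

lemma fps2_exp_x_plus_y: "fps2_exp (var_x + var_y) = fps2_exp var_x * fps2_exp var_y"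
  using fps2_exp_linear[of 1 1] by (simp add: fps2_exp_x fps2_exp_y fps_eq_iff)

lemma fps2_exp_2x_plus_2y:
  "fps2_exp (2 * var_x + 2 * var_y) = Abs_fps (\<lambda>n. fps_const (2 ^ n / fact n) * fps_exp 2)"
  using fps2_exp_linear[of 2 2] by (simp add: numeral_fps_const)

lemma deriv_x_exp:
  "deriv_x (fps2_exp var_x) = fps2_exp var_x"
  "deriv_x (fps2_exp var_y) = 0"
  "deriv_x (fps2_exp (2 * var_x + 2 * var_y)) = 2 * fps2_exp (2 * var_x + 2 * var_y)"
  unfolding fps2_exp_x fps2_exp_y fps2_exp_2x_plus_2y
  by (rule fps_ext; simp add: numeral_fps_const mult_ac)+

lemma of_nat_Suc_divide_fact_Suc: "of_nat (Suc n) * c / fact (Suc n) = (c :: rat) / fact n"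
  by (simp add: divide_simps del: of_nat_Suc)

lemma deriv_y_exp:
  "fps_deriv (fps2_exp var_x) = 0"
  "fps_deriv (fps2_exp var_y) = fps2_exp var_y"
  "fps_deriv (fps2_exp (2 * var_x + 2 * var_y)) = 2 * fps2_exp (2 * var_x + 2 * var_y)"
proof -
  show "fps_deriv (fps2_exp var_x) = 0" by (simp add: fps2_exp_x)
  show "fps_deriv (fps2_exp var_y) = fps2_exp var_y"
    unfolding fps2_exp_y
    by (rule fps_ext) (simp add: fps_of_nat[symmetric] of_nat_Suc_divide_fact_Suc[of _ 1, unfolded mult_1_right]
      del: of_nat_Suc fact_Suc)
  show "fps_deriv (fps2_exp (2 * var_x + 2 * var_y)) = 2 * fps2_exp (2 * var_x + 2 * var_y)"
    unfolding fps2_exp_2x_plus_2y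
  proof (rule fps_ext, rule fps_ext)
    fix n m
    show "fps_nth (fps_nth (fps_deriv (Abs_fps (\<lambda>n. fps_const (2 ^ n / fact n) * fps_exp 2))) n) m =
        fps_nth (fps_nth (2 * Abs_fps (\<lambda>n. fps_const (2 ^ n / fact n) * fps_exp (2::rat))) n) m"
      by (simp add: fps_of_nat[symmetric] numeral_fps_const divide_simps del: of_nat_Suc)
  qed
qed

section \<open>The first order equation along the derivation \<open>L\<close>\<close>

definition transport :: "fps2 \<Rightarrow> fps2" where
  "transport F = deriv_x F - (fps2_exp var_y - 1) * fps_deriv F"

lemma transport_mult: "transport (F * G) = transport F * G + F * transport G"
  by (simp add: transport_def deriv_x_mult algebra_simps)

lemma transport_power3: "transport (F ^ 3) = 3 * F\<^sup>2 * transport F"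
  by (simp add: power3_eq_cube power2_eq_square transport_mult algebra_simps)

lemma transport_denominator:
  fixes D :: fps2
  defines "D \<equiv> fps2_exp var_x + fps2_exp var_y - fps2_exp (var_x + var_y)"
  shows "transport D = (1 - fps2_exp var_y) * D"
  unfolding D_def fps2_exp_x_plus_y
  by (simp add: transport_def deriv_x_add deriv_x_diff deriv_x_mult deriv_x_exp deriv_y_exp
    algebra_simps)

text \<open>The factor matches that of \<open>G * D ^ 3\<close>, namely
  \<open>(1 + e^y) + 3 * (1 - e^y) = 4 - 2 * e^y\<close>; this is where the exponent
  \<open>3\<close> comes from.\<close>

lemma transport_numerator:
  "transport (fps2_exp (2 * var_x + 2 * var_y)) =
     (4 - 2 * fps2_exp var_y) * fps2_exp (2 * var_x + 2 * var_y)"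
  unfolding transport_def deriv_x_exp deriv_y_exp by (simp only: algebra_simps) simp

lemma exp_y_mult_nth:
  "fps_nth (fps_nth (fps2_exp var_y * F) n) m = (\<Sum>i\<le>n. fps_nth (fps_nth F i) m / fact (n - i))"
proof -
  have "fps_nth (F * fps2_exp var_y) n = (\<Sum>i\<le>n. fps_nth F i * fps_const (1 / fact (n - i)))"
    by (simp add: fps_mult_nth fps2_exp_y atMost_atLeast0)
  then show ?thesis
    by (simp only: mult.commute[of _ F] fps_sum_nth fps_mult_right_const_nth) simp
qed

text \<open>Solved for the derivative in \<open>x\<close>, the equation determines the coefficients
  of each power of \<open>x\<close> from those of the preceding one.\<close>

lemma transport_unique:
  assumes "transport F = (4 - 2 * fps2_exp var_y) * F"
    and "\<And>n. fps_nth (fps_nth F n) 0 = 0"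
  shows "F = 0"
proof -
  have eq: "deriv_x F = fps2_exp var_y * (fps_deriv F - 2 * F) + (4 * F - fps_deriv F)"
    using assms(1) by (simp add: transport_def algebra_simps)
  have "\<forall>n. fps_nth (fps_nth F n) m = 0" for m
  proof (induction m)
    case (Suc m)
    \<comment> \<open>The derivative in \<open>y\<close> raises the index \<open>n\<close>, so the
      induction treats all \<open>n\<close> at once. The left side is \<open>m + 1\<close> times the
      next coefficient of \<open>F\<close>.\<close>
    have "fps_nth (fps_nth (deriv_x F) n) m = 0" for n
      unfolding eq fps_add_nth exp_y_mult_nth using Suc by (simp add: numeral_fps_const fps_of_nat[symmetric])
    then show ?case by simp
  qed (use assms(2) in simp)
  then show ?thesis by (simp add: fps_eq_iff)
qed

lemma egf_eq:
  fixes s :: "nat \<Rightarrow> nat \<Rightarrow> rat"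
  assumes s0: "\<And>n. s 0 n = 2 ^ n"
    and sS: "\<And>m n. s (Suc m) n = s m n + (\<Sum>i\<le>Suc n. of_nat (Suc n choose i) * s m i) - s m (Suc n)"
  shows "Abs_fps (\<lambda>n. Abs_fps (\<lambda>m. s m n / (fact m * fact n))) =
           fps2_exp (2 * var_x + 2 * var_y) /
             (fps2_exp var_x + fps2_exp var_y - fps2_exp (var_x + var_y)) ^ 3"
proof -
  define G :: fps2 where "G = Abs_fps (\<lambda>n. Abs_fps (\<lambda>m. s m n / (fact m * fact n)))"
  define D where "D = fps2_exp var_x + fps2_exp var_y - fps2_exp (var_x + var_y)"
  define A where "A = fps2_exp (2 * var_x + 2 * var_y)"
  \<comment> \<open>At \<open>y = 0\<close> the denominator is \<open>e^x + 1 - e^x\<close>.\<close>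
  have D0: "fps_nth D 0 = 1"
    by (simp add: D_def fps2_exp_x_plus_y fps2_exp_x fps2_exp_y)
  \<comment> \<open>The recurrence read off coefficientwise: raising \<open>m\<close> is the
    derivative in \<open>x\<close>, raising \<open>n\<close> the derivative in \<open>y\<close>, and
    the binomial sum up to \<open>Suc n\<close> is the derivative in \<open>y\<close> of
    \<open>e^y * G\<close>.\<close>
  have "deriv_x G = G + fps_deriv (fps2_exp var_y * G) - fps_deriv G"
  proof (rule fps_ext, rule fps_ext)
    fix n m
    have "fps_nth (fps_nth (deriv_x G) n) m = s (Suc m) n / (fact m * fact n)"
      by (simp add: G_def field_simps del: of_nat_Suc)
    moreover have "fps_nth (fps_nth (fps_deriv (fps2_exp var_y * G)) n) m =
        (\<Sum>i\<le>Suc n. of_nat (Suc n choose i) * s m i) / (fact m * fact n)"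
    proof -
      have "fps_nth (fps_nth (fps_deriv (fps2_exp var_y * G)) n) m =
          of_nat (Suc n) * fps_nth (fps_nth (fps2_exp var_y * G) (Suc n)) m"
        by (simp add: fps_of_nat[symmetric] del: of_nat_Suc fps_deriv_mult)
      also have "\<dots> = (\<Sum>i\<le>Suc n. of_nat (Suc n) * (s m i / (fact m * fact i) / fact (Suc n - i)))"
        unfolding exp_y_mult_nth sum_distrib_left by (simp add: G_def)
      also have "\<dots> = (\<Sum>i\<le>Suc n. of_nat (Suc n choose i) * s m i / (fact m * fact n))"
        by (intro sum.cong) (simp_all add: binomial_fact fact_Suc field_simps del: of_nat_Suc)
      finally show ?thesis by (simp only: sum_divide_distrib)
    qed
    moreover have "fps_nth (fps_nth (fps_deriv G) n) m = s m (Suc n) / (fact m * fact n)"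
      by (simp add: G_def fps_of_nat[symmetric] field_simps del: of_nat_Suc)
    moreover have "fps_nth (fps_nth G n) m = s m n / (fact m * fact n)"
      by (simp add: G_def)
    ultimately show "fps_nth (fps_nth (deriv_x G) n) m =
        fps_nth (fps_nth (G + fps_deriv (fps2_exp var_y * G) - fps_deriv G) n) m"
      unfolding fps_sub_nth fps_add_nth by (simp only: sS add_divide_distrib diff_divide_distrib)
  qed
  then have "transport G = (1 + fps2_exp var_y) * G"
    by (simp add: transport_def deriv_y_exp algebra_simps)
  then have W: "transport (G * D ^ 3) = (4 - 2 * fps2_exp var_y) * (G * D ^ 3)"
    unfolding transport_mult transport_power3 transport_denominator[folded D_def]
    by (simp add: algebra_simps power2_eq_square power3_eq_cube)
  have "transport (G * D ^ 3 - A) = transport (G * D ^ 3) - transport A"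
    by (simp add: transport_def deriv_x_diff algebra_simps)
  also have "\<dots> = (4 - 2 * fps2_exp var_y) * (G * D ^ 3 - A)"
    unfolding W A_def transport_numerator by (simp add: algebra_simps)
  finally have "transport (G * D ^ 3 - A) = (4 - 2 * fps2_exp var_y) * (G * D ^ 3 - A)" .
  moreover have "fps_nth (fps_nth (G * D ^ 3 - A) n) 0 = 0" for n
  proof -
    \<comment> \<open>the substitution \<open>x = 0\<close>\<close>
    define at0 where "at0 F = Abs_fps (\<lambda>n. fps_nth (fps_nth F n) 0)" for F :: fps2
    have at0_mult: "at0 (F * H) = at0 F * at0 H" for F H
      by (simp add: at0_def fps_eq_iff fps_mult_nth fps_sum_nth)
    have "at0 D = 1"
      by (simp add: at0_def D_def fps2_exp_x_plus_y fps2_exp_x fps2_exp_y fps_eq_iff)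
    then have "at0 (G * D ^ 3) = at0 G"
      by (simp add: at0_mult power3_eq_cube)
    also have "\<dots> = at0 A"
      by (simp add: at0_def G_def A_def fps2_exp_2x_plus_2y s0)
    finally show ?thesis by (simp add: at0_def fps_eq_iff)
  qed
  ultimately have "G * D ^ 3 - A = 0" by (rule transport_unique)
  then have "G * D ^ 3 = A" by simp
  moreover have "A / D ^ 3 * D ^ 3 = A"
    by (rule fps2_divide_mult_cancel) (simp add: D0 fps_nth_power_0)
  moreover have "D ^ 3 \<noteq> 0" using D0 by auto
  ultimately have "G = A / D ^ 3" by (metis mult_right_cancel)
  then show ?thesis unfolding G_def A_def D_def .
qed

theorem theorem1p1:
  fixes p q :: nat
  assumes "prime p" and "prime q" and "p \<noteq> q"
  shows "(\<forall>m n. (of_nat (num_saturated p q m n) :: rat) =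
            (\<Sum>j = 2..m + 2. (-1) powi (int m - int j) * of_nat (Stirling (m + 1) (j - 1)) *
               (fact j / 2) * of_nat j ^ n))
       \<and> Abs_fps (\<lambda>n. Abs_fps (\<lambda>m. of_nat (num_saturated p q m n) / (fact m * fact n))) =
           fps2_exp (2 * var_x + 2 * var_y) /
             (fps2_exp var_x + fps2_exp var_y - fps2_exp (var_x + var_y)) ^ 3"
proof -
  \<comment> \<open>Both halves of the claim are read off this array: the formula by reindexing, the
    series from the first row and the recurrence in \<open>m\<close>.\<close>
  define s where "s m n = (\<Sum>k\<le>m. saturated_term m k * of_nat (k + 2) ^ n)" for m n
  have s: "of_nat (num_saturated p q m n) = s m n" for m n
    unfolding num_saturated_eq_card_grid[OF assms] card_grid_saturated card_configs s_def ..
  have "s 0 n = 2 ^ n" for n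
    unfolding s_def by (rule saturated_sum_0)
  moreover have "s (Suc m) n = s m n + (\<Sum>i\<le>Suc n. of_nat (Suc n choose i) * s m i) - s m (Suc n)"
    for m n
    unfolding s_def by (rule saturated_sum_Suc)
  ultimately show ?thesis
    unfolding s using egf_eq[of s] by (simp only: s_def saturated_sum_eq simp_thms)
qed

end
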